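(* Let $X\in\mathbb{R}^{n\times p}$, $D\in\mathbb{R}^{m\times p}$, and $\lambda>0$. Let $\psi$ be an essentially smooth and essentially strictly convex function on $\mathbb{R}^n$ with $0\in\mathrm{int}(\mathrm{dom}(\psi))$, and for $y\in\mathbb{R}^n$ consider the problem $$\min_{\beta\in\mathbb{R}^p}\ -y^TX\beta+\psi(X\beta)+\lambda\|D\beta\|_1 .\qquad (P_y)$$ Assume one of the following: (a) $\mathrm{null}(X)\cap\mathrm{null}(D)=\{0\}$, and $X$ is in $D$-general position; or (b) the entries of $X$ are drawn from a distribution that is absolutely continuous on $\mathbb{R}^{np}$, and $p\le n$; or (c) the entries of $X$ are drawn from a distribution that is absolutely continuous on $\mathbb{R}^{np}$, $p>n$, and $\mathrm{nullity}(D)\le n$. In case (a) the following holds deterministically, and in cases (b) or (c) it holds almost surely with respect to the distribution of $X$: for any $y\in\mathcal{N}^c\cap(\mathrm{int}(\mathrm{ran}(\nabla\psi))+C)$, problem $(P_y)$ has a unique solution.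
   Context: Notation. $A^+$ is the Moore–Penrose pseudoinverse of $A$; $P_L$ is the orthogonal projection onto a linear subspace $L$; $\mathrm{nullity}(D)=\dim\mathrm{null}(D)$. For $\mathcal{B}\subseteq\{1,\dots,m\}$, $D_{\mathcal{B}}$ is the submatrix of rows of $D$ indexed by $\mathcal{B}$, and $D_{-\mathcal{B}}=D_{\{1,\dots,m\}\setminus\mathcal{B}}$ (if this has no rows, its null space is $\mathbb{R}^p$). $\mathrm{dom},\mathrm{ran}$ denote domain and range; sums of sets are Minkowski sums. Essentially smooth and essentially strictly convex (Legendre type): $\psi$ is a closed proper convex function, differentiable and strictly convex on the interior of its domain (assumed nonempty), with the norm of its gradient approaching $\infty$ along any sequence approaching the boundary of its domain. $\nabla\psi$ is defined on $\mathrm{int}(\mathrm{dom}(\psi))$. $C=\{v\in\mathbb{R}^n: X^Tv=D^Tu\text{ for some }u\in\mathbb{R}^m,\ \|u\|_\infty\le\lambda\}$. For $\mathcal{B}\subseteq\{1,\dots,m\}$, $s\in\{-1,1\}^{|\mathcal{B}|}$: $$K_{\mathcal{B},s}=\lambda(P_{\mathrm{null}(D_{-\mathcal{B}})}X^T)^+D_{\mathcal{B}}^Ts+\mathrm{null}(P_{\mathrm{null}(D_{-\mathcal{B}})}X^T).$$ For $\mathcal{A}\subseteq\mathcal{B}\subseteq\{1,\dots,m\}$: $$M_{\mathcal{A},\mathcal{B}}=P_{[D_{\mathcal{B}\setminus\mathcal{A}}(\mathrm{null}(X)\cap\mathrm{null}(D_{-\mathcal{B}}))]^\perp}\,D_{\mathcal{B}\setminus\mathcal{A}}\,(XP_{\mathrm{null}(D_{-\mathcal{B}})})^+,$$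 with $M_{\mathcal{A},\mathcal{B}}=0$ by convention when $\mathcal{A}=\mathcal{B}$. Then $$\mathcal{N}=\bigcup_{\mathcal{A},\mathcal{B},s:\ M_{\mathcal{A},\mathcal{B}}\ne0}\Big(K_{\mathcal{B},s}+\nabla\psi\big(\mathrm{col}(XP_{\mathrm{null}(D_{-\mathcal{B}})})\cap\mathrm{null}(M_{\mathcal{A},\mathcal{B}})\cap\mathrm{int}(\mathrm{dom}(\psi))\big)\Big),$$ the union being over all $\mathcal{A}\subseteq\mathcal{B}\subseteq\{1,\dots,m\}$ and $s\in\{-1,1\}^{|\mathcal{B}|}$ with $M_{\mathcal{A},\mathcal{B}}\neq0$. (The sets $C$ and $\mathcal{N}$ depend on $X$.) $D$-general position: $X\in\mathbb{R}^{n\times p}$ is in $D$-general position if for each $\mathcal{B}\subseteq\{1,\dots,m\}$ and $s\in\{-1,1\}^{|\mathcal{B}|}$, there is a matrix $U(\mathcal{B})\in\mathbb{R}^{p\times k(\mathcal{B})}$ whose columns form a basis for $\mathrm{null}(D_{-\mathcal{B}})$, such that for $Z=XU(\mathcal{B})$ (with columns $Z_i$), $\tilde s=U(\mathcal{B})^TD_{\mathcal{B}}^Ts$, and all distinct $i_1,\dots,i_k\in\{1,\dots,k(\mathcal{B})\}$ with $\tilde s_{i_1}\ne0$ and $2\le k\le n+1$: (i) $Z_{i_2}\notin\mathrm{span}(\{Z_{i_3},\dots,Z_{i_k}\})$ when $\tilde s_{i_2}=\cdots=\tilde s_{i_k}=0$; (ii) $Z_{i_1}/\tilde s_{i_1}\notin\mathrm{aff}(\{Z_{i_j}/\tilde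 s_{i_j}:\tilde s_{i_j}\ne0,\ j\ge2\})+\mathrm{span}(\{Z_{i_j}:\tilde s_{i_j}=0\})$ when at least one of $\tilde s_{i_2},\dots,\tilde s_{i_k}$ is nonzero. Here $\mathrm{aff}$ denotes affine span and $\mathrm{span}(\emptyset)=\{0\}$. *)

theory Defs
  imports "HOL-Analysis.Analysis" "HOL-Probability.Probability_Measure"
begin

section \<open>Linear algebra\<close>

definition null_sp :: "real^'p^'n \<Rightarrow> (real^'p) set" where
  "null_sp A = {x. A *v x = 0}"

definition col_sp :: "real^'p^'n \<Rightarrow> (real^'n) set" where
  "col_sp A = range ((*v) A)"

definition nullity :: "real^'p^'n \<Rightarrow> nat" where
  "nullity A = dim (null_sp A)"

text \<open>Matrix of the orthogonal projection onto a linear subspace \<open>L\<close>.\<close>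

definition proj :: "(real^'n) set \<Rightarrow> real^'n^'n" where
  "proj L = (THE P. \<forall>x. P *v x \<in> L \<and> x - P *v x \<in> L\<^sup>\<bottom>)"

text \<open>Moore--Penrose pseudoinverse, given by the four Penrose equations.\<close>

definition is_pinv :: "real^'p^'n \<Rightarrow> real^'n^'p \<Rightarrow> bool" where
  "is_pinv A B \<longleftrightarrow> A ** B ** A = A \<and> B ** A ** B = B \<and>
     transpose (A ** B) = A ** B \<and> transpose (B ** A) = B ** A"

definition pinv :: "real^'p^'n \<Rightarrow> real^'n^'p" where
  "pinv A = (THE B. is_pinv A B)"

text \<open>The row submatrix \<open>D\<^sub>B\<close> is kept in the full index type by replacing the rows outside
  \<open>B\<close> with zero rows. Inserting zero rows changes neither the null space nor \<open>D\<^sub>B\<^sup>T s\<close> (the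
  entries of \<open>s\<close> outside \<open>B\<close> are ignored), and for \<open>B = {}\<close> the null space is everything.\<close>

definition rows_on :: "real^'p^'m \<Rightarrow> 'm set \<Rightarrow> real^'p^'m" where
  "rows_on D B = (\<chi> i. if i \<in> B then D $ i else 0)"

text \<open>Accordingly, elements of \<open>{-1,1}\<^sup>B\<close> are represented by vectors whose entries
  outside \<open>B\<close> are arbitrary.\<close>

definition sign_on :: "'m set \<Rightarrow> real^'m \<Rightarrow> bool" where
  "sign_on B s \<longleftrightarrow> (\<forall>i\<in>B. s $ i \<in> {-1, 1})"

section \<open>Extended-valued convex functions\<close>

definition edom :: "('a \<Rightarrow> ereal) \<Rightarrow> 'a set" where
  "edom \<psi> = {x. \<psi> x < \<infinity>}"

definition epi :: "('a \<Rightarrow> ereal) \<Rightarrow> ('a \<times> real) set" where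
  "epi \<psi> = {(x, r). \<psi> x \<le> ereal r}"

definition closed_proper_convex :: "('a::euclidean_space \<Rightarrow> ereal) \<Rightarrow> bool" where
  "closed_proper_convex \<psi> \<longleftrightarrow>
     convex (epi \<psi>) \<and> closed (epi \<psi>) \<and> (\<forall>x. \<psi> x \<noteq> -\<infinity>) \<and> edom \<psi> \<noteq> {}"

definition strictly_convex_on :: "'a::real_vector set \<Rightarrow> ('a \<Rightarrow> real) \<Rightarrow> bool" where
  "strictly_convex_on S f \<longleftrightarrow> convex S \<and>
     (\<forall>x\<in>S. \<forall>y\<in>S. \<forall>t. x \<noteq> y \<and> 0 < t \<and> t < 1 \<longrightarrow>
        f ((1 - t) *\<^sub>R x + t *\<^sub>R y) < (1 - t) * f x + t * f y)"

text \<open>Only meaningful at points of \<open>interior (edom \<psi>)\<close> where \<open>\<psi>\<close> is differentiable.\<close>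

definition grad :: "('a::euclidean_space \<Rightarrow> ereal) \<Rightarrow> 'a \<Rightarrow> 'a" where
  "grad \<psi> x = (THE g. GDERIV (\<lambda>z. real_of_ereal (\<psi> z)) x :> g)"

text \<open>Functions of Legendre type: essentially smooth and essentially strictly convex.\<close>

definition legendre :: "('a::euclidean_space \<Rightarrow> ereal) \<Rightarrow> bool" where
  "legendre \<psi> \<longleftrightarrow> closed_proper_convex \<psi> \<and>
     interior (edom \<psi>) \<noteq> {} \<and>
     (\<forall>x\<in>interior (edom \<psi>). (\<lambda>z. real_of_ereal (\<psi> z)) differentiable (at x)) \<and>
     strictly_convex_on (interior (edom \<psi>)) (\<lambda>z. real_of_ereal (\<psi> z)) \<and>
     (\<forall>xs x. (\<forall>k::nat. xs k \<in> interior (edom \<psi>)) \<and> xs \<longlonglongrightarrow> x \<and> x \<in> frontier (edom \<psi>) \<longrightarrow>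
        filterlim (\<lambda>k. norm (grad \<psi> (xs k))) at_top sequentially)"

definition grad_ran :: "('a::euclidean_space \<Rightarrow> ereal) \<Rightarrow> 'a set" where
  "grad_ran \<psi> = grad \<psi> ` interior (edom \<psi>)"

section \<open>The generalized lasso problem\<close>

definition objective ::
  "real^'p^'n \<Rightarrow> real^'p^'m \<Rightarrow> real \<Rightarrow> (real^'n \<Rightarrow> ereal) \<Rightarrow> real^'n \<Rightarrow> real^'p \<Rightarrow> ereal" where
  "objective X D lam \<psi> y \<beta> =
     ereal (- (y \<bullet> (X *v \<beta>))) + \<psi> (X *v \<beta>) + ereal (lam * (\<Sum>i\<in>UNIV. \<bar>(D *v \<beta>) $ i\<bar>))"

definition is_solution ::
  "real^'p^'n \<Rightarrow> real^'p^'m \<Rightarrow> real \<Rightarrow> (real^'n \<Rightarrow> ereal) \<Rightarrow> real^'n \<Rightarrow> real^'p \<Rightarrow> bool" where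
  "is_solution X D lam \<psi> y \<beta> \<longleftrightarrow> is_arg_min (objective X D lam \<psi> y) (\<lambda>_. True) \<beta>"

definition C_set :: "real^'p^'n \<Rightarrow> real^'p^'m \<Rightarrow> real \<Rightarrow> (real^'n) set" where
  "C_set X D lam = {v. \<exists>u. transpose X *v v = transpose D *v u \<and> infnorm u \<le> lam}"

definition K_set :: "real^'p^'n \<Rightarrow> real^'p^'m \<Rightarrow> real \<Rightarrow> 'm set \<Rightarrow> real^'m \<Rightarrow> (real^'n) set" where
  "K_set X D lam B s =
     (let Q = proj (null_sp (rows_on D (- B))) ** transpose X
      in (lam *\<^sub>R (pinv Q *v (transpose (rows_on D B) *v s))) +o null_sp Q)"

text \<open>With zero rows in place of missing ones, \<open>M_mat\<close> is the matrix \<open>M\<^sub>A\<^sub>,\<^sub>B\<close> with zero rows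
  inserted outside \<open>B - A\<close>: the projection may act as the identity on the additional
  coordinates, but those of \<open>D\<^bsub>B-A\<^esub>\<close> vanish. So \<open>null_sp\<close> and being zero are unaffected, and
  the convention \<open>M\<^sub>A\<^sub>,\<^sub>A = 0\<close> holds automatically.\<close>

definition M_mat :: "real^'p^'n \<Rightarrow> real^'p^'m \<Rightarrow> 'm set \<Rightarrow> 'm set \<Rightarrow> real^'n^'m" where
  "M_mat X D A B =
     proj ((((*v) (rows_on D (B - A))) ` (null_sp X \<inter> null_sp (rows_on D (- B))))\<^sup>\<bottom>)
       ** rows_on D (B - A) ** pinv (X ** proj (null_sp (rows_on D (- B))))"

definition N_set ::
  "real^'p^'n \<Rightarrow> real^'p^'m \<Rightarrow> real \<Rightarrow> (real^'n \<Rightarrow> ereal) \<Rightarrow> (real^'n) set" where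
  "N_set X D lam \<psi> =
     (\<Union>(A, B, s) \<in> {(A, B, s). A \<subseteq> B \<and> sign_on B s \<and> M_mat X D A B \<noteq> 0}.
        K_set X D lam B s +
        grad \<psi> ` (col_sp (X ** proj (null_sp (rows_on D (- B)))) \<inter> null_sp (M_mat X D A B)
                   \<inter> interior (edom \<psi>)))"

text \<open>The columns of \<open>U(B)\<close> are \<open>U 1, \<dots>, U kB\<close>; the matrix itself may depend on \<open>s\<close> as well
  as on \<open>B\<close>, since it is chosen for each pair.\<close>

definition D_general_position :: "real^'p^'m \<Rightarrow> real^'p^'n \<Rightarrow> bool" where
  "D_general_position D X \<longleftrightarrow>
    (\<forall>B s. sign_on B s \<longrightarrow>
      (\<exists>kB (U :: nat \<Rightarrow> real^'p).
        inj_on U {1..kB} \<and> independent (U ` {1..kB}) \<and>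
        span (U ` {1..kB}) = null_sp (rows_on D (- B)) \<and>
        (let Z = (\<lambda>i. X *v U i);
             st = (\<lambda>i. U i \<bullet> (transpose (rows_on D B) *v s))
         in \<forall>k i. 2 \<le> k \<and> k \<le> CARD('n) + 1 \<and>
              inj_on i {1..k} \<and> i ` {1..k} \<subseteq> {1..kB} \<and> st (i 1) \<noteq> 0 \<longrightarrow>
              ((\<forall>j\<in>{2..k}. st (i j) = 0) \<longrightarrow>
                 Z (i 2) \<notin> span {Z (i j) | j. j \<in> {3..k}}) \<and>
              ((\<exists>j\<in>{2..k}. st (i j) \<noteq> 0) \<longrightarrow>
                 Z (i 1) /\<^sub>R st (i 1) \<notin>
                   (affine hull {Z (i j) /\<^sub>R st (i j) | j. j \<in> {2..k} \<and> st (i j) \<noteq> 0})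
                   + span {Z (i j) | j. j \<in> {1..k} \<and> st (i j) = 0}))))"

section \<open>Well-definedness of the projection matrix and of the pseudoinverse\<close>

lemma linear_selection:
  fixes R :: "'a::real_vector \<Rightarrow> 'b::real_vector \<Rightarrow> bool"
  assumes ex: "\<And>x. R x (f x)" and uniq: "\<And>x y z. R x y \<Longrightarrow> R x z \<Longrightarrow> y = z"
    and add: "\<And>x y x' y'. R x y \<Longrightarrow> R x' y' \<Longrightarrow> R (x + x') (y + y')"
    and scale: "\<And>c x y. R x y \<Longrightarrow> R (c *\<^sub>R x) (c *\<^sub>R y)"
  shows "linear f"
proof (rule linearI)
  show "f (x + y) = f x + f y" for x y using uniq[OF ex add[OF ex ex]] .
  show "f (c *\<^sub>R x) = c *\<^sub>R f x" for c x using uniq[OF ex scale[OF ex]] .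
qed

lemma orth_decomp_ex:
  fixes L :: "(real^'n) set"
  assumes "subspace L"
  shows "\<exists>y\<in>L. x - y \<in> L\<^sup>\<bottom>"
proof -
  have "x \<in> L + L\<^sup>\<bottom>" using subspace_sum_orthogonal_comp[OF assms] by simp
  then obtain y z where "x = y + z" "y \<in> L" "z \<in> L\<^sup>\<bottom>" by (rule set_plus_elim)
  then show ?thesis by (intro bexI[of _ y]) auto
qed

lemma orth_decomp_unique:
  fixes L :: "(real^'n) set"
  assumes L: "subspace L" and "y \<in> L" "z \<in> L" "x - y \<in> L\<^sup>\<bottom>" "x - z \<in> L\<^sup>\<bottom>"
  shows "y = z"
proof -
  have "(x - z) - (x - y) \<in> L\<^sup>\<bottom>"
    using assms subspace_orthogonal_comp subspace_diff by blast
  then have "y - z \<in> L \<inter> L\<^sup>\<bottom>" using assms subspace_diff[OF L] by (simp add: algebra_simps)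
  then show ?thesis using orthogonal_Int_0[OF L] by auto
qed

lemma proj_ex1:
  fixes L :: "(real^'n) set"
  assumes L: "subspace L"
  shows "\<exists>!P. \<forall>x. P *v x \<in> L \<and> x - P *v x \<in> L\<^sup>\<bottom>"
proof -
  obtain f where f: "\<And>x. f x \<in> L \<and> x - f x \<in> L\<^sup>\<bottom>"
    using orth_decomp_ex[OF L] by metis
  have "linear f"
  proof (rule linear_selection[where R = "\<lambda>x y. y \<in> L \<and> x - y \<in> L\<^sup>\<bottom>"])
    fix x y x' y' assume a: "y \<in> L \<and> x - y \<in> L\<^sup>\<bottom>" "y' \<in> L \<and> x' - y' \<in> L\<^sup>\<bottom>"
    have "(x - y) + (x' - y') \<in> L\<^sup>\<bottom>"
      using a subspace_orthogonal_comp subspace_add by blast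
    then show "y + y' \<in> L \<and> x + x' - (y + y') \<in> L\<^sup>\<bottom>"
      using a subspace_add[OF L] by (simp add: algebra_simps)
  next
    fix c x y assume a: "y \<in> L \<and> x - y \<in> L\<^sup>\<bottom>"
    have "c *\<^sub>R (x - y) \<in> L\<^sup>\<bottom>" using a subspace_orthogonal_comp subspace_scale by blast
    then show "c *\<^sub>R y \<in> L \<and> c *\<^sub>R x - c *\<^sub>R y \<in> L\<^sup>\<bottom>"
      using a subspace_scale[OF L] by (simp add: algebra_simps)
  qed (use f orth_decomp_unique[OF L] in blast)+
  then have m: "matrix f *v x = f x" for x by (simp add: matrix_works)
  show ?thesis
  proof (rule ex1I[of _ "matrix f"])
    show "\<forall>x. matrix f *v x \<in> L \<and> x - matrix f *v x \<in> L\<^sup>\<bottom>" using f m by simp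
  next
    fix P assume P: "\<forall>x. P *v x \<in> L \<and> x - P *v x \<in> L\<^sup>\<bottom>"
    have "P *v x = matrix f *v x" for x
      unfolding m using orth_decomp_unique[OF L, of "P *v x" "f x" x] P f by blast
    then show "P = matrix f" by (simp add: matrix_eq)
  qed
qed

lemma proj_in: "subspace L \<Longrightarrow> proj L *v x \<in> L"
  and proj_orth: "subspace L \<Longrightarrow> x - proj L *v x \<in> L\<^sup>\<bottom>"
  using theI'[OF proj_ex1, of L] unfolding proj_def by auto

lemma subspace_null_sp: "subspace (null_sp A)"
  by (auto simp: null_sp_def subspace_def matrix_vector_right_distrib matrix_vector_mult_scaleR)

lemma subspace_col_sp: "subspace (col_sp A)"
  unfolding col_sp_def by (simp add: linear_subspace_image)

lemma proj_inner:
  assumes "subspace L"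
  shows "(proj L *v x) \<bullet> y = (proj L *v x) \<bullet> (proj L *v y)"
  using proj_in[OF assms, of x] proj_orth[OF assms, of y]
  by (auto simp: orthogonal_comp_def orthogonal_def inner_diff_right)

lemma transpose_proj:
  assumes "subspace L"
  shows "transpose (proj L) = proj L"
proof -
  have "(transpose (proj L) *v x) \<bullet> y = (proj L *v x) \<bullet> y" for x y
    using proj_inner[OF assms, of x y] proj_inner[OF assms, of y x]
    by (metis dot_lmul_matrix inner_commute transpose_matrix_vector)
  then have "transpose (proj L) *v x = proj L *v x" for x
    by (subst vector_eq_rdot[symmetric]) blast
  then show ?thesis by (simp add: matrix_eq)
qed

lemma is_pinv_unique:
  assumes "is_pinv A B" "is_pinv A C"
  shows "B = C"
proof -
  have AB: "A ** B = A ** C"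
  proof -
    have "A ** B = transpose (A ** B)" using assms by (simp add: is_pinv_def)
    also have "\<dots> = transpose ((A ** C) ** (A ** B))"
      using assms by (metis is_pinv_def matrix_mul_assoc)
    also have "\<dots> = (A ** B) ** (A ** C)"
      using assms by (simp add: is_pinv_def matrix_transpose_mul[of "A ** C" "A ** B"])
    also have "\<dots> = A ** C" using assms by (metis is_pinv_def matrix_mul_assoc)
    finally show ?thesis .
  qed
  have BA: "B ** A = C ** A"
  proof -
    have "B ** A = transpose (B ** A)" using assms by (simp add: is_pinv_def)
    also have "\<dots> = transpose ((B ** A) ** (C ** A))"
      using assms by (metis is_pinv_def matrix_mul_assoc)
    also have "\<dots> = (C ** A) ** (B ** A)"
      using assms by (simp add: is_pinv_def matrix_transpose_mul[of "B ** A" "C ** A"])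
    also have "\<dots> = C ** A" using assms by (metis is_pinv_def matrix_mul_assoc)
    finally show ?thesis .
  qed
  have "B = B ** (A ** B)" using assms by (metis is_pinv_def matrix_mul_assoc)
  also have "\<dots> = C ** A ** C" using AB BA by (simp add: matrix_mul_assoc)
  also have "\<dots> = C" using assms by (simp add: is_pinv_def)
  finally show ?thesis .
qed

lemma is_pinv_ex:
  fixes A :: "real^'p^'n"
  shows "\<exists>B. is_pinv A B"
proof -
  define L where "L = col_sp A"
  define R where "R = (null_sp A)\<^sup>\<bottom>"
  have L: "subspace L" and R: "subspace R"
    by (auto simp: L_def R_def subspace_col_sp subspace_orthogonal_comp)
  have AR: "A *v (proj R *v x) = A *v x" for x
  proof -
    have "x - proj R *v x \<in> null_sp A"
      using proj_orth[OF R, of x] orthogonal_comp_self[OF subspace_null_sp[of A]]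
      by (simp add: R_def)
    then show ?thesis by (simp add: null_sp_def matrix_vector_mult_diff_distrib)
  qed
  have inj: "x = y" if "x \<in> R" "y \<in> R" "A *v x = A *v y" for x y
  proof -
    have "x - y \<in> null_sp A" using that by (simp add: null_sp_def matrix_vector_mult_diff_distrib)
    moreover have "x - y \<in> R" using that R subspace_diff by blast
    ultimately show ?thesis
      using orthogonal_Int_0[OF subspace_null_sp[of A]] unfolding R_def
      by (metis IntI eq_iff_diff_eq_0 singletonD)
  qed
  have "\<exists>x. x \<in> R \<and> A *v x = proj L *v y" for y
  proof -
    obtain x where "proj L *v y = A *v x"
      using proj_in[OF L, of y] unfolding L_def col_sp_def by blast
    then show ?thesis using proj_in[OF R, of x] AR[of x] by metis
  qed
  then obtain f where f: "\<And>y. f y \<in> R \<and> A *v f y = proj L *v y" by metis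
  have "linear f"
    by (rule linear_selection[where R = "\<lambda>y x. x \<in> R \<and> A *v x = proj L *v y"])
      (use f inj in \<open>auto simp: matrix_vector_right_distrib matrix_vector_mult_scaleR
         subspace_add[OF R] subspace_scale[OF R]\<close>)
  then have mf: "matrix f *v y = f y" for y by (simp add: matrix_works)
  have AB: "A ** matrix f = proj L"
    using f by (simp add: matrix_eq mf flip: matrix_vector_mul_assoc)
  have projL: "proj L *v (A *v x) = A *v x" for x
    using orth_decomp_unique[OF L proj_in[OF L] _ proj_orth[OF L], of "A *v x" "A *v x"]
    by (auto simp: L_def col_sp_def subspace_0 subspace_orthogonal_comp)
  have BA: "matrix f ** A = proj R"
    using f inj proj_in[OF R] AR projL
    by (simp add: matrix_eq mf flip: matrix_vector_mul_assoc)
  have "A ** matrix f ** A = A"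
    by (simp add: AB matrix_eq projL flip: matrix_vector_mul_assoc)
  moreover have "matrix f ** A ** matrix f = matrix f"
    unfolding BA using f inj proj_in[OF R] AR
    by (simp add: matrix_eq mf flip: matrix_vector_mul_assoc)
  ultimately have "is_pinv A (matrix f)"
    by (simp add: is_pinv_def AB BA transpose_proj L R)
  then show ?thesis by blast
qed

lemma is_pinv_pinv: "is_pinv A (pinv A)"
  unfolding pinv_def using is_pinv_ex is_pinv_unique by (metis theI)

lemma M_mat_self: "M_mat X D A A = 0"
proof -
  have "rows_on D (A - A) = 0" by (simp add: rows_on_def vec_eq_iff)
  then show ?thesis by (simp add: M_mat_def)
qed

end

theory Submission
  imports Defs
begin

text \<open>Existence: writing \<open>y = g + v\<close> with \<open>X\<^sup>T v = D\<^sup>T u\<close>, the objective is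
  \<open>(\<psi> - g)(X \<beta>) + (\<lambda> \<parallel>D \<beta>\<parallel>\<^sub>1 - u \<bullet> D \<beta>)\<close>. The first summand grows linearly in \<open>X \<beta>\<close>, the second
  is nonnegative and equals \<open>\<lambda> \<parallel>D \<beta>\<parallel>\<^sub>1\<close> on \<open>null X\<close>, so the objective is coercive as soon as
  \<open>null X \<inter> null D = {0}\<close>.

  Uniqueness: essential smoothness forces \<open>X \<beta>\<close> into the interior of the domain for every
  solution, and strict convexity then makes \<open>X \<beta>\<close> unique. Let \<open>\<beta>\<close> be the midpoint of two solutions,
  \<open>A\<close> the support of \<open>D \<beta>\<close>, \<open>s\<close> its signs and \<open>L = null D\<^bsub>-A\<^esub>\<close>; both solutions lie in \<open>L\<close>.
  Stationarity within \<open>L\<close> gives \<open>r\<close> with \<open>r \<bullet> X d = D\<^sub>A\<^sup>T s \<bullet> d\<close> for \<open>d \<in> L\<close>. If \<open>D\<^sub>A\<^sup>T s\<close> is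
  orthogonal to \<open>L\<close>, then \<open>\<parallel>D \<beta>\<parallel>\<^sub>1 = 0\<close> and the solutions differ by an element of
  \<open>null X \<inter> null D\<close>. Otherwise genericity of \<open>X\<close> gives \<open>null X \<inter> L = {0}\<close>. General position implies
  this genericity, and it holds for almost every \<open>X\<close> because \<open>null X\<close> almost surely meets a fixed
  subspace of dimension at most \<open>n\<close> trivially.\<close>

section \<open>Matrices singular on a subspace\<close>

text \<open>Applying \<open>h\<close> to a vanishing combination and subtracting \<open>a\<close>
  times that combination removes the eigenvector for \<open>a\<close> and multiplies each other
  coefficient by \<open>t - a\<close>. These factors are nonzero because the family is indexed by
  its eigenvalues.\<close>

lemma eigenvectors_inj_independent:
  fixes h :: "'a::real_vector \<Rightarrow> 'a"
  assumes lin: "linear h" and "finite T"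
    and v: "\<And>t. t \<in> T \<Longrightarrow> v t \<noteq> 0" "\<And>t. t \<in> T \<Longrightarrow> h (v t) = t *\<^sub>R v t"
    and "(\<Sum>t\<in>T. c t *\<^sub>R v t) = 0" "t \<in> T"
  shows "c t = 0"
  using \<open>finite T\<close> v assms(5,6)
proof (induction T arbitrary: c t rule: finite_induct)
  case (insert a T)
  let ?s = "\<Sum>t\<in>T. c t *\<^sub>R v t"
  have s: "c a *\<^sub>R v a + ?s = 0" using insert by simp
  have "h (c a *\<^sub>R v a + ?s) = (c a * a) *\<^sub>R v a + (\<Sum>t\<in>T. (c t * t) *\<^sub>R v t)"
    using lin insert.prems(1,2) by (simp add: linear_add linear_scale linear_sum)
  then have "(c a * a) *\<^sub>R v a + (\<Sum>t\<in>T. (c t * t) *\<^sub>R v t) = 0"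
    using s linear_0[OF lin] by simp
  moreover have "a *\<^sub>R (c a *\<^sub>R v a + ?s) = 0" using s by simp
  then have "(c a * a) *\<^sub>R v a + (\<Sum>t\<in>T. (c t * a) *\<^sub>R v t) = 0"
    by (simp add: scaleR_add_right scaleR_sum_right mult.commute)
  ultimately have "(\<Sum>t\<in>T. (c t * (t - a)) *\<^sub>R v t) = 0"
    by (simp add: right_diff_distrib scaleR_diff_left sum_subtractf) (metis add_left_cancel)
  then have "\<And>t. t \<in> T \<Longrightarrow> c t * (t - a) = 0"
    using insert.IH[of "\<lambda>t. c t * (t - a)"] insert.prems(1,2) by blast
  then have T0: "\<And>t. t \<in> T \<Longrightarrow> c t = 0" using insert.hyps by force
  then have "c a *\<^sub>R v a = 0" using s by simp
  then show ?case using T0 insert.prems by auto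
qed simp

text \<open>Passes from coefficient-wise independence of an indexed family to independence of its
  image, so that dimension bounds count indices and not just distinct vectors.\<close>

lemma inj_independent_family:
  fixes Z :: "'i \<Rightarrow> 'a::euclidean_space"
  assumes "finite T" and ind: "\<And>c t. (\<Sum>i\<in>T. c i *\<^sub>R Z i) = 0 \<Longrightarrow> t \<in> T \<Longrightarrow> c t = (0::real)"
  shows "inj_on Z T" "independent (Z ` T)"
proof -
  show inj: "inj_on Z T"
  proof (rule inj_onI, rule ccontr)
    fix i j assume ij: "i \<in> T" "j \<in> T" "Z i = Z j" "i \<noteq> j"
    let ?c = "\<lambda>x. (if x = i then 1 else 0) - (if x = j then 1 else (0::real))"
    have "(\<Sum>x\<in>T. ?c x *\<^sub>R Z x) = 0"
      using ij \<open>finite T\<close>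
      by (simp add: scaleR_diff_left sum_subtractf if_distrib[of "\<lambda>a. a *\<^sub>R _"] cong: if_cong)
    from ind[OF this ij(1)] show False using ij by simp
  qed
  show "independent (Z ` T)"
  proof (rule independent_if_scalars_zero)
    fix f x assume "(\<Sum>x\<in>Z ` T. f x *\<^sub>R x) = 0" "x \<in> Z ` T"
    then show "f x = 0" using ind[of "f \<circ> Z"] inj by (auto simp: sum.reindex)
  qed (use assms in simp)
qed

text \<open>One eigenvector for each of \<open>Suc DIM('a)\<close> eigenvalues would give an
  independent set larger than the dimension.\<close>

lemma finite_eigenvalues:
  fixes h :: "'a::euclidean_space \<Rightarrow> 'a"
  assumes "linear h"
  shows "finite {t. \<exists>b. b \<noteq> 0 \<and> h b = t *\<^sub>R b}" (is "finite ?E")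
proof (rule ccontr)
  assume "infinite ?E"
  then obtain T where T: "finite T" "card T = Suc DIM('a)" "T \<subseteq> ?E"
    using infinite_arbitrarily_large by blast
  then have "\<forall>t\<in>T. \<exists>b. b \<noteq> 0 \<and> h b = t *\<^sub>R b" by blast
  then obtain v where "\<And>t. t \<in> T \<Longrightarrow> v t \<noteq> 0 \<and> h (v t) = t *\<^sub>R v t" by metis
  then have "inj_on v T" "independent (v ` T)"
    using inj_independent_family[OF T(1), of v] eigenvectors_inj_independent[OF assms T(1), of v]
    by blast+
  then show False using T independent_bound[of "v ` T"] by (simp add: card_image)
qed

section \<open>Topology and measure of the set of singular matrices\<close>

lemma closed_singular_on:
  fixes F :: "(real^'p) set"
  assumes "closed F"
  shows "closed {X :: real^'p^'n. \<exists>b. b \<in> F \<inter> sphere 0 1 \<and> X *v b = 0}"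
proof -
  have "closed {(b, X :: real^'p^'n). X *v b = 0}"
    unfolding case_prod_unfold matrix_vector_mult_def
    by (intro closed_Collect_eq continuous_intros)
  \<comment> \<open>Normalising null vectors to the unit sphere makes the projected-out factor
    compact, so the projection stays closed.\<close>
  from closed_compact_projection[OF _ this, of "F \<inter> sphere 0 1"] show ?thesis
    using assms by (simp add: closed_Int_compact)
qed

lemma null_sp_Int_eq_0_iff:
  assumes "subspace F"
  shows "null_sp X \<inter> F = {0} \<longleftrightarrow> \<not> (\<exists>b. b \<in> F \<inter> sphere 0 1 \<and> X *v b = 0)"
proof -
  have "\<exists>b. b \<in> F \<inter> sphere 0 1 \<and> X *v b = 0" if b: "b \<in> null_sp X \<inter> F" "b \<noteq> 0" for b
    using b assms by (intro exI[of _ "b /\<^sub>R norm b"])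
      (auto simp: null_sp_def subspace_scale matrix_vector_mult_scaleR)
  moreover have "0 \<in> null_sp X \<inter> F"
    using assms by (simp add: subspace_0 subspace_null_sp)
  moreover have "b \<in> null_sp X \<inter> F \<and> b \<noteq> 0" if "b \<in> F \<inter> sphere 0 1" "X *v b = 0" for b
    using that by (auto simp: null_sp_def)
  ultimately show ?thesis by blast
qed

text \<open>Along every line in the direction of a matrix \<open>E\<close> that is injective on \<open>F\<close>, singularity
  on \<open>F\<close> is an eigenvalue condition and so occurs only finitely often; Fubini then applies.\<close>

lemma AE_null_sp_Int_eq_0:
  fixes F :: "(real^'p) set"
  assumes F: "subspace F" and dim: "dim F \<le> CARD('n)"
  shows "AE X in lborel. null_sp (X :: real^'p^'n) \<inter> F = {0}"
proof -
  define S where "S = {X :: real^'p^'n. \<exists>b. b \<in> F \<inter> sphere 0 1 \<and> X *v b = 0}"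
  have "closed S" unfolding S_def by (rule closed_singular_on) (simp add: F closed_subspace)
  then have S[measurable]: "S \<in> sets borel" by simp
  \<comment> \<open>The bound on \<open>dim F\<close> enters here: it leaves room for an isometric
    copy of \<open>F\<close> in the target space.\<close>
  obtain f :: "real^'p \<Rightarrow> real^'n" where f: "linear f" "\<And>x. x \<in> F \<Longrightarrow> norm (f x) = norm x"
    using isometry_subset_subspace[OF F subspace_UNIV, where ?'b = "real^'n"] dim
    by (auto simp: dim_UNIV)
  have "inj_on f F"
  proof (rule inj_onI)
    fix x y assume "x \<in> F" "y \<in> F" "f x = f y"
    then show "x = y" using f(2)[of "x - y"] subspace_diff[OF F] linear_diff[OF f(1)] by simp
  qed
  \<comment> \<open>The left inverse \<open>g\<close> turns
    \<open>X *v b = - t *\<^sub>R f b\<close> into an eigenvalue equation for the composition of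
    \<open>X\<close> and \<open>g\<close>.\<close>
  then obtain g where g: "linear g" "\<And>v. v \<in> F \<Longrightarrow> g (f v) = v"
    using linear_exists_left_inverse_on[OF f(1) F] by blast
  define E where "E = matrix f"
  have E: "E *v x = f x" for x by (simp add: E_def f(1) matrix_works)
  have fin: "finite {t. X + t *\<^sub>R E \<in> S}" for X
  proof (rule finite_subset)
    show "finite ((\<lambda>t. - t) ` {t. \<exists>b. b \<noteq> 0 \<and> g (X *v b) = t *\<^sub>R b})"
      using finite_eigenvalues[OF linear_compose[OF matrix_vector_mul_linear g(1), of X]]
      by (simp add: comp_def)
    show "{t. X + t *\<^sub>R E \<in> S} \<subseteq> (\<lambda>t. - t) ` {t. \<exists>b. b \<noteq> 0 \<and> g (X *v b) = t *\<^sub>R b}"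
    proof clarify
      fix t assume "X + t *\<^sub>R E \<in> S"
      then obtain b where b: "b \<in> F" "norm b = 1" "X *v b + t *\<^sub>R f b = 0"
        by (auto simp: S_def matrix_vector_mult_add_rdistrib E simp flip: scaleR_matrix_vector_assoc)
      then have "g (X *v b) + t *\<^sub>R b = 0"
        using g linear_add[OF g(1)] linear_scale[OF g(1)] linear_0[OF g(1)] by metis
      then have "g (X *v b) = (- t) *\<^sub>R b" by (simp add: add_eq_0_iff)
      moreover have "b \<noteq> 0" using b by auto
      ultimately show "t \<in> (\<lambda>t. - t) ` {t. \<exists>b. b \<noteq> 0 \<and> g (X *v b) = t *\<^sub>R b}"
        by (intro image_eqI[of _ _ "- t"]) auto
    qed
  qed
  have meas: "(\<lambda>(t, X). indicator S (X + t *\<^sub>R E) :: ennreal)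
      \<in> borel_measurable (lborel \<Otimes>\<^sub>M lborel)" by measurable
  \<comment> \<open>By translation invariance the inner integral is the measure of \<open>S\<close>
    for every \<open>t\<close>, so integrating over the whole line multiplies it by infinity. In the
    other order the double integral is 0, which forces \<open>S\<close> to be null.\<close>
  have "emeasure lborel S * \<infinity> = (\<integral>\<^sup>+t. (\<integral>\<^sup>+X. indicator S (X + t *\<^sub>R E) \<partial>lborel) \<partial>(lborel :: real measure))"
  proof -
    have "(\<integral>\<^sup>+X. indicator S (X + t *\<^sub>R E) \<partial>lborel) = emeasure lborel S" for t
    proof -
      have "emeasure lborel S = (\<integral>\<^sup>+X. indicator S X \<partial>distr lborel borel ((+) (t *\<^sub>R E)))"
        by (simp add: lborel_distr_plus)
      also have "\<dots> = (\<integral>\<^sup>+X. indicator S (X + t *\<^sub>R E) \<partial>lborel)"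
        by (subst nn_integral_distr) (auto simp: add.commute)
      finally show ?thesis by simp
    qed
    then show ?thesis by simp
  qed
  also have "\<dots> = (\<integral>\<^sup>+X. (\<integral>\<^sup>+t. indicator S (X + t *\<^sub>R E) \<partial>(lborel :: real measure)) \<partial>lborel)"
    using lborel_pair.Fubini'[OF meas] by simp
  also have "\<dots> = 0"
  proof -
    have "(\<integral>\<^sup>+t. indicator S (X + t *\<^sub>R E) \<partial>(lborel :: real measure)) = 0" for X
    proof -
      have "(\<integral>\<^sup>+t. indicator S (X + t *\<^sub>R E) \<partial>(lborel :: real measure))
          = (\<integral>\<^sup>+t. indicator {t. X + t *\<^sub>R E \<in> S} t \<partial>lborel)"
        by (intro nn_integral_cong) (simp add: indicator_def)
      also have "\<dots> = emeasure lborel {t. X + t *\<^sub>R E \<in> S}"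
        using fin[of X] by (intro nn_integral_indicator) (simp add: finite_imp_closed borel_closed)
      also have "\<dots> = 0" using fin[of X] by (simp add: finite_imp_null_set_lborel null_setsD1)
      finally show ?thesis .
    qed
    then show ?thesis by simp
  qed
  finally have "emeasure lborel S = 0" by (simp add: ennreal_mult_eq_top_iff)
  then have "S \<in> null_sets lborel" by (simp add: null_sets_def)
  then have "AE X in lborel. X \<notin> S" by (rule AE_not_in)
  then show ?thesis by (simp add: S_def null_sp_Int_eq_0_iff[OF F])
qed

text \<open>If \<open>dim L\<close> is at most the number of rows, the conclusion holds almost
  surely. Otherwise the premise fails almost surely: \<open>X\<close> maps some \<open>F\<close>
  inside \<open>L\<close>, orthogonal to \<open>w\<close>, bijectively onto the target, so
  \<open>X *v e = X *v f\<close> with \<open>f \<in> F\<close>, and \<open>e - f\<close> is a null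
  vector not orthogonal to \<open>w\<close>.\<close>

lemma AE_not_orthogonal_null_sp:
  fixes L :: "(real^'p) set" and w :: "real^'p"
  assumes L: "subspace L" and e: "e \<in> L" "w \<bullet> e \<noteq> 0"
  shows "AE X in lborel. (\<forall>d\<in>null_sp (X :: real^'p^'n) \<inter> L. w \<bullet> d = 0) \<longrightarrow> null_sp X \<inter> L = {0}"
proof (cases "dim L \<le> CARD('n)")
  case True
  show ?thesis using AE_null_sp_Int_eq_0[OF L True] by eventually_elim simp
next
  case False
  define L' where "L' = L \<inter> {x. w \<bullet> x = 0}"
  have L': "subspace L'" unfolding L'_def using L by (intro subspace_inter subspace_hyperplane)
  have "L \<subseteq> span (insert e L')"
  proof
    fix x assume x: "x \<in> L"
    let ?a = "(w \<bullet> x) / (w \<bullet> e)"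
    have "x - ?a *\<^sub>R e \<in> L'"
      using x e L by (simp add: L'_def inner_diff_right subspace_diff subspace_scale)
    then have "(x - ?a *\<^sub>R e) + ?a *\<^sub>R e \<in> span (insert e L')"
      by (intro span_add span_scale span_base) auto
    then show "x \<in> span (insert e L')" by simp
  qed
  then have "dim L \<le> dim (insert e L')" by (metis dim_span dim_subset)
  \<comment> \<open>Intersecting with the hyperplane lowers the dimension by at most one, and
    \<open>dim L\<close> exceeds \<open>CARD('n)\<close>.\<close>
  then have "CARD('n) \<le> dim L'" using False by (simp add: dim_insert split: if_splits)
  then obtain F where F: "subspace F" "F \<subseteq> span L'" "dim F = CARD('n)"
    using choose_subspace_of_subspace by blast
  have FL: "F \<subseteq> L'" using F L' span_eq_iff by blast
  have *: "\<exists>d\<in>null_sp X \<inter> L. w \<bullet> d \<noteq> 0" if X: "null_sp X \<inter> F = {0}" for X :: "real^'p^'n"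
  proof -
    have "inj_on ((*v) X) F"
    proof (rule inj_onI)
      fix x y assume "x \<in> F" "y \<in> F" "X *v x = X *v y"
      then have "x - y \<in> null_sp X \<inter> F"
        using F by (simp add: null_sp_def subspace_diff matrix_vector_mult_diff_distrib)
      then show "x = y" using X by simp
    qed
    then have "dim ((*v) X ` F) = CARD('n)"
      using F by (subst dim_image_eq) (auto simp: span_eq_iff[THEN iffD2])
    then have "span ((*v) X ` F) = UNIV" by (simp add: dim_eq_full[symmetric])
    then have "(*v) X ` F = UNIV" using F by (metis linear_subspace_image matrix_vector_mul_linear span_eq_iff)
    then obtain f where f: "f \<in> F" "X *v e = X *v f" by (metis UNIV_I imageE)
    then show ?thesis using e FL L
      by (intro bexI[of _ "e - f"])
        (auto simp: L'_def null_sp_def inner_diff_right matrix_vector_mult_diff_distrib subspace_diff)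
  qed
  have "AE X in lborel. null_sp (X :: real^'p^'n) \<inter> F = {0}"
    using F by (intro AE_null_sp_Int_eq_0) auto
  then show ?thesis by eventually_elim (use * in blast)
qed

section \<open>Sign genericity\<close>

text \<open>The premise on \<open>r\<close> is what stationarity supplies at a solution, with
  \<open>r\<close> the residual \<open>y - grad \<psi> (X *v \<beta>)\<close> divided by
  \<open>lam\<close>.\<close>

definition sign_generic :: "real^'p^'m \<Rightarrow> real^'p^'n \<Rightarrow> bool" where
  "sign_generic D X \<longleftrightarrow>
    (\<forall>B s. sign_on B s \<longrightarrow>
      (let L = null_sp (rows_on D (- B)); w = transpose (rows_on D B) *v s
       in (\<exists>r. \<forall>d\<in>L. r \<bullet> (X *v d) = w \<bullet> d) \<longrightarrow> (\<exists>e\<in>L. w \<bullet> e \<noteq> 0) \<longrightarrow>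
          null_sp X \<inter> L = {0}))"

lemma AE_sign_generic:
  fixes D :: "real^'p^'m"
  shows "AE X in lborel. sign_generic D (X :: real^'p^'n)"
proof -
  \<comment> \<open>Entries of a sign vector outside \<open>B\<close> are arbitrary, so there are
    infinitely many of them. Only the set \<open>P\<close> of indices with entry 1 matters, which
    leaves finitely many almost sure events to intersect.\<close>
  define w where "w B P = transpose (rows_on D B) *v (\<chi> i. if i \<in> P then 1 else - 1)"
    for B P :: "'m set"
  define Q where "Q B P X \<longleftrightarrow> (\<forall>d\<in>null_sp X \<inter> null_sp (rows_on D (- B)). w B P \<bullet> d = 0) \<longrightarrow>
      null_sp X \<inter> null_sp (rows_on D (- B)) = {0}" for B P and X :: "real^'p^'n"
  have "AE X in lborel. (\<exists>e\<in>null_sp (rows_on D (- B)). w B P \<bullet> e \<noteq> 0) \<longrightarrow> Q B P X" for B P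
    unfolding Q_def
    by (cases "\<exists>e\<in>null_sp (rows_on D (- B)). w B P \<bullet> e \<noteq> 0")
      (auto intro: AE_not_orthogonal_null_sp subspace_null_sp)
  then have "AE X in lborel. \<forall>B\<in>UNIV. \<forall>P\<in>UNIV.
      (\<exists>e\<in>null_sp (rows_on D (- B)). w B P \<bullet> e \<noteq> 0) \<longrightarrow> Q B P X"
    by (intro AE_finite_allI finite_class.finite_UNIV)
  then show ?thesis
  proof eventually_elim
    case (elim X)
    show ?case unfolding sign_generic_def Let_def
    proof (intro allI impI)
      fix B and s :: "real^'m"
      assume s: "sign_on B s"
        and r: "\<exists>r. \<forall>d\<in>null_sp (rows_on D (- B)). r \<bullet> (X *v d) = (transpose (rows_on D B) *v s) \<bullet> d"
        and e: "\<exists>e\<in>null_sp (rows_on D (- B)). (transpose (rows_on D B) *v s) \<bullet> e \<noteq> 0"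
      have w: "transpose (rows_on D B) *v s = w B {i. s $ i = 1}"
        using s unfolding w_def
        by (auto simp: vec_eq_iff matrix_vector_mult_def transpose_def rows_on_def sign_on_def
            intro!: sum.cong)
      have "Q B {i. s $ i = 1} X" using elim e unfolding w by blast
      moreover have "w B {i. s $ i = 1} \<bullet> d = 0" if "d \<in> null_sp X \<inter> null_sp (rows_on D (- B))" for d
        using r that unfolding w by (auto simp: null_sp_def)
      ultimately show "null_sp X \<inter> null_sp (rows_on D (- B)) = {0}" unfolding Q_def by blast
    qed
  qed
qed

section \<open>Minimal linear dependences and general position\<close>

lemma obtain_circuit:
  fixes Z :: "'i \<Rightarrow> 'a::real_vector"
  assumes "finite I" "(\<Sum>i\<in>I. c i *\<^sub>R Z i) = 0" "i \<in> I" "c i \<noteq> (0::real)"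
  obtains S c where "S \<subseteq> I" "S \<noteq> {}" "(\<Sum>i\<in>S. c i *\<^sub>R Z i) = 0" "\<And>i. i \<in> S \<Longrightarrow> c i \<noteq> (0::real)"
    "\<And>T b t. T \<subset> S \<Longrightarrow> (\<Sum>i\<in>T. b i *\<^sub>R Z i) = 0 \<Longrightarrow> t \<in> T \<Longrightarrow> b t = (0::real)"
proof -
  \<comment> \<open>\<open>P S\<close> says that \<open>S\<close> carries a nontrivial relation. A
    set of least cardinality with this property is a circuit: proper subfamilies are independent,
    and a zero coefficient could be dropped to give a smaller such set.\<close>
  define P where "P S \<longleftrightarrow> S \<subseteq> I \<and> (\<exists>c. (\<Sum>i\<in>S. c i *\<^sub>R Z i) = 0 \<and> (\<exists>i\<in>S. c i \<noteq> (0::real)))" for S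
  have "P I" using assms by (auto simp: P_def)
  define S where "S = arg_min card P"
  have PS: "P S" and min: "\<And>T. P T \<Longrightarrow> card S \<le> card T"
    unfolding S_def using arg_min_nat_lemma[of P I card] \<open>P I\<close> by auto
  have fin: "finite S" using PS assms(1) finite_subset by (auto simp: P_def)
  have indep: "b t = 0" if "T \<subset> S" "(\<Sum>i\<in>T. b i *\<^sub>R Z i) = 0" "t \<in> T" for T b t
  proof (rule ccontr)
    assume "b t \<noteq> 0"
    then have "P T" using that PS by (auto simp: P_def)
    then show False using min[of T] psubset_card_mono[OF fin that(1)] by simp
  qed
  obtain c where c: "(\<Sum>i\<in>S. c i *\<^sub>R Z i) = 0" "\<exists>i\<in>S. c i \<noteq> 0" using PS by (auto simp: P_def)
  have "c i \<noteq> 0" if "i \<in> S" for i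
  proof
    assume "c i = 0"
    then have "(\<Sum>j\<in>S - {i}. c j *\<^sub>R Z j) = 0" using c(1) fin that by (simp add: sum.remove)
    moreover have "\<exists>j\<in>S - {i}. c j \<noteq> 0" using c(2) \<open>c i = 0\<close> by auto
    ultimately show False using indep[of "S - {i}" c] that by blast
  qed
  moreover have "S \<noteq> {}" "S \<subseteq> I" using c PS by (auto simp: P_def)
  ultimately show thesis using that c(1) indep by blast
qed

text \<open>The family \<open>p\<close> may repeat points, so the argument translates by one of them
  and works in the span of the differences instead of assigning coefficients to the image.\<close>

lemma affine_combination_in_hull:
  fixes p :: "'i \<Rightarrow> 'a::real_vector"
  assumes "finite T" "(\<Sum>i\<in>T. a i) = 1"
  shows "(\<Sum>i\<in>T. a i *\<^sub>R p i) \<in> affine hull (p ` T)"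
proof -
  obtain k where k: "k \<in> T" using assms(2) by (cases "T = {}") auto
  have "(\<Sum>i\<in>T. a i *\<^sub>R (p i - p k)) \<in> span ((\<lambda>x. x - p k) ` (p ` T))"
    by (intro span_sum span_scale span_base) auto
  moreover have "(\<Sum>i\<in>T. a i *\<^sub>R (p i - p k)) = (\<Sum>i\<in>T. a i *\<^sub>R p i) - p k"
    using assms(2) by (simp add: scaleR_diff_right sum_subtractf flip: scaleR_sum_left)
  moreover have "affine hull (p ` T) = (\<lambda>x. p k + x) ` span ((\<lambda>x. x - p k) ` (p ` T))"
    using affine_hull_span_gen[of "p k" "p ` T"] k by (simp add: hull_inc)
  ultimately show ?thesis by (simp add: image_iff) (metis add_diff_cancel_left' diff_add_cancel add.commute)
qed

text \<open>Produces the index tuples quantified over in \<open>D_general_position\<close>, whose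
  first position is distinguished.\<close>

lemma obtain_enumeration_from_1:
  assumes "finite T" "a \<notin> T"
  obtains i :: "nat \<Rightarrow> 'a" where "i 1 = a" "bij_betw i {2..card T + 1} T" "inj_on i {1..card T + 1}"
    "i ` {1..card T + 1} = insert a T"
proof -
  obtain h where h: "bij_betw h {1..card T} T" using assms(1) ex_bij_betw_nat_finite_1 by blast
  define i where "i k = (if k = 1 then a else h (k - 1))" for k
  have "bij_betw (\<lambda>k. k - 1) {2..card T + 1} {1..card T}"
    by (rule bij_betw_byWitness[of _ "\<lambda>k. k + 1"]) auto
  then have "bij_betw (h \<circ> (\<lambda>k. k - 1)) {2..card T + 1} T" using h by (rule bij_betw_trans)
  then have b: "bij_betw i {2..card T + 1} T"
    by (rule bij_betw_cong[THEN iffD1, rotated]) (auto simp: i_def)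
  have i1: "i 1 = a" by (simp add: i_def)
  have "{1..card T + 1} = insert 1 {2..card T + 1}" by auto
  moreover have "inj_on i (insert 1 {2..card T + 1})" "i ` insert 1 {2..card T + 1} = insert a T"
    using b assms(2) i1 by (auto simp: bij_betw_def)
  ultimately show thesis using that[OF i1 b] by simp
qed

text \<open>A nonzero null vector in the subspace yields a circuit \<open>S\<close> among the
  columns \<open>Z i\<close>. If \<open>st\<close> is nonzero somewhere on \<open>S\<close>, pairing
  the relation with \<open>r\<close> exhibits a forbidden affine combination. If \<open>st\<close>
  vanishes on \<open>S\<close> and \<open>S\<close> is small, a forbidden linear dependence appears.
  If \<open>S\<close> is large, its columns span the whole space and are orthogonal to
  \<open>r\<close>, so \<open>r = 0\<close>, which contradicts
  \<open>r \<bullet> Z i0 = st i0\<close>.\<close>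

lemma sign_generic_if_D_general_position:
  fixes X :: "real^'p^'n" and D :: "real^'p^'m"
  assumes gp: "D_general_position D X"
  shows "sign_generic D X"
  unfolding sign_generic_def Let_def
proof (intro allI impI)
  fix B and s :: "real^'m"
  define w where "w = transpose (rows_on D B) *v s"
  assume s: "sign_on B s"
    and "\<exists>r. \<forall>d\<in>null_sp (rows_on D (- B)). r \<bullet> (X *v d) = (transpose (rows_on D B) *v s) \<bullet> d"
    and "\<exists>e\<in>null_sp (rows_on D (- B)). (transpose (rows_on D B) *v s) \<bullet> e \<noteq> 0"
  then obtain r e where r: "\<And>d. d \<in> null_sp (rows_on D (- B)) \<Longrightarrow> r \<bullet> (X *v d) = w \<bullet> d"
    and e: "e \<in> null_sp (rows_on D (- B))" "w \<bullet> e \<noteq> 0" unfolding w_def by blast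
  obtain kB and U :: "nat \<Rightarrow> real^'p" where U: "inj_on U {1..kB}" "independent (U ` {1..kB})"
      "span (U ` {1..kB}) = null_sp (rows_on D (- B))"
    and position: "let Z = (\<lambda>i. X *v U i); st = (\<lambda>i. U i \<bullet> w)
       in \<forall>k i. 2 \<le> k \<and> k \<le> CARD('n) + 1 \<and>
            inj_on i {1..k} \<and> i ` {1..k} \<subseteq> {1..kB} \<and> st (i 1) \<noteq> 0 \<longrightarrow>
            ((\<forall>j\<in>{2..k}. st (i j) = 0) \<longrightarrow> Z (i 2) \<notin> span {Z (i j) | j. j \<in> {3..k}}) \<and>
            ((\<exists>j\<in>{2..k}. st (i j) \<noteq> 0) \<longrightarrow>
               Z (i 1) /\<^sub>R st (i 1) \<notin>
                 (affine hull {Z (i j) /\<^sub>R st (i j) | j. j \<in> {2..k} \<and> st (i j) \<noteq> 0})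
                 + span {Z (i j) | j. j \<in> {1..k} \<and> st (i j) = 0})"
    using gp[unfolded D_general_position_def, THEN spec, THEN spec, THEN mp, OF s, folded w_def]
    by (elim exE conjE) (rule that)
  define Z where "Z i = X *v U i" for i
  define st where "st i = U i \<bullet> w" for i
  have gp1: "Z (i 2) \<notin> span {Z (i j) | j. j \<in> {3..k}}"
    if "2 \<le> k" "k \<le> CARD('n) + 1" "inj_on i {1..k}" "i ` {1..k} \<subseteq> {1..kB}" "st (i 1) \<noteq> 0"
      "\<forall>j\<in>{2..k}. st (i j) = 0" for i k
    using position that unfolding Let_def Z_def st_def by blast
  have gp2: "Z (i 1) /\<^sub>R st (i 1) \<notin>
      (affine hull {Z (i j) /\<^sub>R st (i j) | j. j \<in> {2..k} \<and> st (i j) \<noteq> 0})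
      + span {Z (i j) | j. j \<in> {1..k} \<and> st (i j) = 0}"
    if "2 \<le> k" "k \<le> CARD('n) + 1" "inj_on i {1..k}" "i ` {1..k} \<subseteq> {1..kB}" "st (i 1) \<noteq> 0"
      "\<exists>j\<in>{2..k}. st (i j) \<noteq> 0" for i k
    using position that unfolding Let_def Z_def st_def by blast
  have U_in: "U i \<in> null_sp (rows_on D (- B))" if "i \<in> {1..kB}" for i
    using U(3) that span_base[of "U i" "U ` {1..kB}"] by blast
  have rZ: "r \<bullet> Z i = st i" if "i \<in> {1..kB}" for i
    using r[OF U_in[OF that]] by (simp add: Z_def st_def inner_commute)
  have "\<exists>i\<in>{1..kB}. st i \<noteq> 0"
  proof (rule ccontr)
    assume "\<not> ?thesis"
    then have "orthogonal w u" if "u \<in> U ` {1..kB}" for u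
      using that by (auto simp: st_def orthogonal_def inner_commute)
    moreover have "e \<in> span (U ` {1..kB})" using e(1) U(3) by blast
    ultimately have "orthogonal w e" using orthogonal_to_span by blast
    then show False using e(2) by (simp add: orthogonal_def)
  qed
  then obtain i0 where i0: "i0 \<in> {1..kB}" "st i0 \<noteq> 0" by blast
  have "b = 0" if b: "b \<in> null_sp X" "b \<in> null_sp (rows_on D (- B))" for b
  proof (rule ccontr)
    assume "b \<noteq> 0"
    have "b \<in> span (U ` {1..kB})" using b(2) U(3) by simp
    then obtain u where "b = (\<Sum>v\<in>U ` {1..kB}. u v *\<^sub>R v)" using span_finite[of "U ` {1..kB}"] by auto
    then have bc: "b = (\<Sum>i\<in>{1..kB}. u (U i) *\<^sub>R U i)" using U(1) by (simp add: sum.reindex)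
    have "\<exists>i\<in>{1..kB}. u (U i) \<noteq> 0"
    proof (rule ccontr)
      assume "\<not> ?thesis" then show False using bc \<open>b \<noteq> 0\<close> by simp
    qed
    then obtain i1 where i1: "i1 \<in> {1..kB}" "u (U i1) \<noteq> 0" by blast
    have "(\<Sum>i\<in>{1..kB}. u (U i) *\<^sub>R Z i) = X *v b"
      by (simp add: bc Z_def linear_sum[OF matrix_vector_mul_linear] matrix_vector_mult_scaleR)
    then have "(\<Sum>i\<in>{1..kB}. u (U i) *\<^sub>R Z i) = 0" using b(1) by (simp add: null_sp_def)
    then obtain S c where S: "S \<subseteq> {1..kB}" "S \<noteq> {}" and c: "(\<Sum>i\<in>S. c i *\<^sub>R Z i) = 0" "\<And>i. i \<in> S \<Longrightarrow> c i \<noteq> 0"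
      and indep: "\<And>T b t. T \<subset> S \<Longrightarrow> (\<Sum>i\<in>T. b i *\<^sub>R Z i) = 0 \<Longrightarrow> t \<in> T \<Longrightarrow> b t = (0::real)"
      using obtain_circuit[of "{1..kB}" "\<lambda>i. u (U i)" Z i1] i1 by auto
    have fin: "finite S" using S(1) finite_subset by auto
    have sub: "inj_on Z T" "independent (Z ` T)" if "T \<subset> S" for T
      using inj_independent_family[of T Z] indep[OF that] finite_subset[OF _ fin] that by blast+
    \<comment> \<open>This bounds the length \<open>card T + 1\<close> of the tuples below by
      \<open>CARD('n) + 1\<close>, the largest length that general position covers.\<close>
    have card_sub: "card T \<le> CARD('n)" if "T \<subset> S" for T
      using independent_bound[OF sub(2)[OF that]] sub(1)[OF that] by (simp add: card_image)
    have "(\<Sum>i\<in>S. c i * st i) = r \<bullet> (\<Sum>i\<in>S. c i *\<^sub>R Z i)"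
      using rZ S(1) by (auto simp: inner_sum_right intro!: sum.cong)
    then have cst: "(\<Sum>i\<in>S. c i * st i) = 0" using c(1) by simp
    have solve: "Z j = (\<Sum>i\<in>S - {j}. (- c i / c j) *\<^sub>R Z i)" if "j \<in> S" for j
    proof -
      have "c j *\<^sub>R Z j = - (\<Sum>i\<in>S - {j}. c i *\<^sub>R Z i)"
        using c(1) that fin by (simp add: sum.remove eq_neg_iff_add_eq_0)
      then have "(1 / c j) *\<^sub>R (c j *\<^sub>R Z j) = (1 / c j) *\<^sub>R (- (\<Sum>i\<in>S - {j}. c i *\<^sub>R Z i))" by simp
      then show ?thesis using c(2)[OF that] by (simp add: scaleR_sum_right sum_negf)
    qed
    show False
    proof (cases "\<exists>j\<in>S. st j \<noteq> 0")
      case True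
      then obtain j where j: "j \<in> S" "st j \<noteq> 0" by blast
      define T where "T = S - {j}"
      have T: "finite T" "j \<notin> T" "insert j T = S" "T \<subset> S" using fin j by (auto simp: T_def)
      \<comment> \<open>Solving the circuit relation for \<open>Z j\<close> and dividing by
        \<open>st j\<close> gives these weights on the points \<open>Z i /\<^sub>R st i\<close>. By
        \<open>cst\<close> they sum to 1.\<close>
      define a where "a i = - c i * st i / (c j * st j)" for i
      have cj: "c j \<noteq> 0" using c(2) j by blast
      have "c j * st j + (\<Sum>i\<in>T. c i * st i) = 0" using cst T by (metis sum.insert)
      then have "(\<Sum>i\<in>T. - c i * st i) = c j * st j" by (simp add: sum_negf)
      moreover have "(\<Sum>i\<in>T. a i) = (\<Sum>i\<in>T. - c i * st i) / (c j * st j)"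
        by (simp add: a_def sum_divide_distrib)
      ultimately have a1: "(\<Sum>i\<in>T. a i) = 1" using j cj by simp
      define T1 where "T1 = {i\<in>T. st i \<noteq> 0}"
      define T0 where "T0 = {i\<in>T. st i = 0}"
      have a1': "(\<Sum>i\<in>T1. a i) = 1"
        using a1 T(1) by (subst (asm) sum.mono_neutral_right[of T T1]) (auto simp: T1_def a_def)
      then have "T1 \<noteq> {}" by auto
      obtain i where i: "i 1 = j" "bij_betw i {2..card T + 1} T" "inj_on i {1..card T + 1}"
        "i ` {1..card T + 1} = insert j T"
        using obtain_enumeration_from_1[OF T(1,2)] by metis
      have img: "i ` {2..card T + 1} = T" using i(2) by (simp add: bij_betw_def)
      have sets1: "{Z (i l) /\<^sub>R st (i l) | l. l \<in> {2..card T + 1} \<and> st (i l) \<noteq> 0} = (\<lambda>i. Z i /\<^sub>R st i) ` T1"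
      proof -
        have "{Z (i l) /\<^sub>R st (i l) | l. l \<in> {2..card T + 1} \<and> st (i l) \<noteq> 0} =
            (\<lambda>i. Z i /\<^sub>R st i) ` {x \<in> i ` {2..card T + 1}. st x \<noteq> 0}" by auto
        then show ?thesis by (simp only: img T1_def)
      qed
      have sets0: "Z ` T0 \<subseteq> {Z (i l) | l. l \<in> {1..card T + 1} \<and> st (i l) = 0}"
      proof clarify
        fix x assume "x \<in> T0"
        then have "x \<in> i ` {1..card T + 1}" "st x = 0" unfolding i(4) T0_def by auto
        then show "\<exists>l. Z x = Z (i l) \<and> l \<in> {1..card T + 1} \<and> st (i l) = 0" by auto
      qed
      have "Z j /\<^sub>R st j = (\<Sum>i\<in>T. (- c i / (c j * st j)) *\<^sub>R Z i)"
        unfolding solve[OF j(1)] T_def[symmetric] scaleR_sum_right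
        by (intro sum.cong) (simp_all add: divide_inverse mult.commute)
      also have "\<dots> = (\<Sum>i\<in>T1. (- c i / (c j * st j)) *\<^sub>R Z i) + (\<Sum>i\<in>T0. (- c i / (c j * st j)) *\<^sub>R Z i)"
      proof -
        have T_eq: "T = T1 \<union> T0" and "T1 \<inter> T0 = {}" "finite T1" "finite T0"
          using T(1) by (auto simp: T0_def T1_def)
        then show ?thesis unfolding T_eq by (intro sum.union_disjoint)
      qed
      also have "(\<Sum>i\<in>T1. (- c i / (c j * st j)) *\<^sub>R Z i) = (\<Sum>i\<in>T1. a i *\<^sub>R (Z i /\<^sub>R st i))"
        by (intro sum.cong) (auto simp: T1_def a_def)
      finally have eq: "Z j /\<^sub>R st j = (\<Sum>i\<in>T1. a i *\<^sub>R (Z i /\<^sub>R st i)) + (\<Sum>i\<in>T0. (- c i / (c j * st j)) *\<^sub>R Z i)" .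
      have aff: "(\<Sum>i\<in>T1. a i *\<^sub>R (Z i /\<^sub>R st i)) \<in> affine hull ((\<lambda>i. Z i /\<^sub>R st i) ` T1)"
        using T(1) a1' by (intro affine_combination_in_hull) (auto simp: T1_def)
      have spn: "(\<Sum>i\<in>T0. (- c i / (c j * st j)) *\<^sub>R Z i) \<in> span (Z ` T0)"
        by (intro span_sum span_scale span_base) auto
      have "Z (i 1) /\<^sub>R st (i 1) \<in>
          (affine hull {Z (i l) /\<^sub>R st (i l) | l. l \<in> {2..card T + 1} \<and> st (i l) \<noteq> 0})
          + span {Z (i l) | l. l \<in> {1..card T + 1} \<and> st (i l) = 0}"
        unfolding sets1 i(1) eq using aff spn span_mono[OF sets0] by (intro set_plus_intro) blast+
      moreover have "T \<noteq> {}" using \<open>T1 \<noteq> {}\<close> by (auto simp: T1_def)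
      then have "2 \<le> card T + 1" using T(1) by (simp add: Suc_le_eq card_gt_0_iff)
      moreover have "\<exists>l\<in>{2..card T + 1}. st (i l) \<noteq> 0"
      proof -
        obtain x where x: "x \<in> T" "st x \<noteq> 0" using \<open>T1 \<noteq> {}\<close> by (auto simp: T1_def)
        have "x \<in> i ` {2..card T + 1}" unfolding img by (rule x)
        then show ?thesis using x(2) by auto
      qed
      ultimately show False
        using gp2[of "card T + 1" i] i j card_sub[OF T(4)] S(1) T(3) by auto
    next
      case False
      have S0: "i0 \<notin> S" using False i0 by blast
      show False
      proof (cases "card S \<le> CARD('n)")
        case True
        \<comment> \<open>The index \<open>i0\<close> lies outside the circuit and only fills the
          first position, where a nonzero sign is required.\<close>
        obtain i where i: "i 1 = i0" "bij_betw i {2..card S + 1} S" "inj_on i {1..card S + 1}"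
          "i ` {1..card S + 1} = insert i0 S"
          using obtain_enumeration_from_1[OF fin S0] by metis
        have k: "2 \<le> card S + 1" using fin S(2) by (simp add: Suc_le_eq card_gt_0_iff)
        have img: "i ` {2..card S + 1} = S" using i(2) by (simp add: bij_betw_def)
        have i2: "i 2 \<in> S" using img k by auto
        have "{2..card S + 1} = insert 2 {3..card S + 1}" using k by auto
        then have "S - {i 2} \<subseteq> i ` {3..card S + 1}" using img by auto
        then have "Z ` (S - {i 2}) \<subseteq> {Z (i l) | l. l \<in> {3..card S + 1}}" by blast
        moreover have "Z (i 2) \<in> span (Z ` (S - {i 2}))"
          by (subst solve[OF i2]) (intro span_sum span_scale span_base, auto)
        ultimately have "Z (i 2) \<in> span {Z (i l) | l. l \<in> {3..card S + 1}}" using span_mono by blast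
        moreover have "st (i l) = 0" if "l \<in> {2..card S + 1}" for l
          using imageI[OF that, of i] False unfolding img by blast
        ultimately show False using gp1[of "card S + 1" i] i i0 k True S(1) by force
      next
        case large: False
        obtain j where j: "j \<in> S" using S(2) by blast
        then have T: "S - {j} \<subset> S" by auto
        \<comment> \<open>The cardinality is squeezed: \<open>S\<close> has more than
          \<open>CARD('n)\<close> elements, while its proper subset has at most that many.\<close>
        have "card (Z ` (S - {j})) = CARD('n)"
          using card_sub[OF T] large fin j by (simp add: card_image[OF sub(1)[OF T]])
        then have "UNIV \<subseteq> span (Z ` (S - {j}))"
          using sub(2)[OF T] by (intro card_ge_dim_independent) auto
        moreover have "orthogonal r z" if "z \<in> Z ` (S - {j})" for z
          using that rZ S(1) False by (auto simp: orthogonal_def)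
        ultimately have "orthogonal r r" using orthogonal_to_span[of r "Z ` (S - {j})" r] by blast
        then have "r = 0" by (simp add: orthogonal_def)
        then show False using rZ[OF i0(1)] i0(2) by simp
      qed
    qed
  qed
  then show "null_sp X \<inter> null_sp (rows_on D (- B)) = {0}"
    using subspace_0[OF subspace_null_sp[of X]]
      subspace_0[OF subspace_null_sp[of "rows_on D (- B)"]] by blast
qed

section \<open>Functions of Legendre type\<close>

text \<open>Meaningful on \<open>edom \<psi>\<close> only: \<open>real_of_ereal\<close> sends
  infinite values to 0.\<close>

definition rval :: "('a \<Rightarrow> ereal) \<Rightarrow> 'a \<Rightarrow> real" where
  "rval \<psi> x = real_of_ereal (\<psi> x)"

lemma ereal_rval:
  assumes "closed_proper_convex \<psi>" "x \<in> edom \<psi>"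
  shows "\<psi> x = ereal (rval \<psi> x)"
  using assms by (cases "\<psi> x") (auto simp: closed_proper_convex_def edom_def rval_def)

lemma mem_epi_iff:
  assumes "closed_proper_convex \<psi>"
  shows "(x, r) \<in> epi \<psi> \<longleftrightarrow> x \<in> edom \<psi> \<and> rval \<psi> x \<le> r"
proof (cases "x \<in> edom \<psi>")
  case True
  then show ?thesis using ereal_rval[OF assms, of x] by (simp add: epi_def)
next
  case False
  then show ?thesis by (simp add: epi_def edom_def)
qed

lemma convex_on_rval:
  assumes "closed_proper_convex \<psi>"
  shows "convex_on (edom \<psi>) (rval \<psi>)"
proof -
  have *: "u *\<^sub>R x + v *\<^sub>R y \<in> edom \<psi> \<and> rval \<psi> (u *\<^sub>R x + v *\<^sub>R y) \<le> u * rval \<psi> x + v * rval \<psi> y"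
    if "x \<in> edom \<psi>" "y \<in> edom \<psi>" "0 \<le> u" "0 \<le> v" "u + v = 1" for x y u v
  proof -
    have "(x, rval \<psi> x) \<in> epi \<psi>" "(y, rval \<psi> y) \<in> epi \<psi>"
      using that by (simp_all add: mem_epi_iff[OF assms])
    then have "u *\<^sub>R (x, rval \<psi> x) + v *\<^sub>R (y, rval \<psi> y) \<in> epi \<psi>"
      using assms that unfolding closed_proper_convex_def by (blast intro: convexD)
    then show ?thesis by (simp add: mem_epi_iff[OF assms])
  qed
  then have "convex (edom \<psi>)" by (simp add: convex_def)
  then show ?thesis using * by (simp add: convex_on_def)
qed

text \<open>The derivative \<open>f\<close> is represented by the vector \<open>adjoint f 1\<close>,
  and uniqueness of derivatives justifies the definite description in \<open>grad\<close>.\<close>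

lemma GDERIV_grad:
  assumes "rval \<psi> differentiable (at x)"
  shows "GDERIV (rval \<psi>) x :> grad \<psi> x"
proof -
  obtain f where f: "(rval \<psi> has_derivative f) (at x)" using assms by (auto simp: differentiable_def)
  then have lin: "linear f" by (simp add: has_derivative_linear)
  have "f h = h \<bullet> adjoint f 1" for h using adjoint_works[OF lin, of h 1] by simp
  then have ex: "GDERIV (rval \<psi>) x :> adjoint f 1"
    using f by (simp add: gderiv_def) (metis (no_types, lifting) ext f)
  have "D = adjoint f 1" if "GDERIV (rval \<psi>) x :> D" for D
  proof -
    have "(\<lambda>h. h \<bullet> D) = (\<lambda>h. h \<bullet> adjoint f 1)"
      using has_derivative_unique[OF that[unfolded gderiv_def] ex[unfolded gderiv_def]] .
    then show ?thesis by (metis vector_eq_ldot)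
  qed
  then show ?thesis
    using ex theI[of "\<lambda>g. GDERIV (rval \<psi>) x :> g"] unfolding grad_def rval_def[abs_def] by blast
qed

lemma GDERIV_line:
  fixes f :: "'a::euclidean_space \<Rightarrow> real"
  assumes "GDERIV f x :> g"
  shows "((\<lambda>t. f (x + t *\<^sub>R d)) has_real_derivative g \<bullet> d) (at 0)"
proof -
  have "((\<lambda>t. x + t *\<^sub>R d) has_derivative (\<lambda>t. t *\<^sub>R d)) (at 0)"
    by (auto intro!: derivative_eq_intros)
  moreover have "(f has_derivative (\<lambda>h. h \<bullet> g)) (at (x + 0 *\<^sub>R d))" using assms by (simp add: gderiv_def)
  ultimately have "((\<lambda>t. f (x + t *\<^sub>R d)) has_derivative (\<lambda>t. (t *\<^sub>R d) \<bullet> g)) (at 0)"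
    by (rule has_derivative_compose)
  then show ?thesis by (simp add: has_field_derivative_def inner_commute mult_commute_abs)
qed

text \<open>Convexity bounds the difference quotients on the segment from \<open>x\<close> to
  \<open>z\<close> by \<open>rval \<psi> z - rval \<psi> x\<close>; the bound passes to the limit at
  0 from the right.\<close>

lemma gradient_inequality:
  assumes cpc: "closed_proper_convex \<psi>" and x: "x \<in> edom \<psi>" "z \<in> edom \<psi>"
    and diff: "rval \<psi> differentiable (at x)"
  shows "rval \<psi> x + grad \<psi> x \<bullet> (z - x) \<le> rval \<psi> z"
proof -
  have "((\<lambda>t. rval \<psi> (x + t *\<^sub>R (z - x))) has_real_derivative grad \<psi> x \<bullet> (z - x)) (at 0)"
    by (intro GDERIV_line GDERIV_grad diff)
  then have "((\<lambda>t. (rval \<psi> (x + t *\<^sub>R (z - x)) - rval \<psi> x) / t) \<longlongrightarrow> grad \<psi> x \<bullet> (z - x)) (at_right 0)"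
    unfolding has_field_derivative_iff
    by (intro tendsto_mono[OF at_le[of "{0<..}" UNIV]]) simp_all
  moreover have "\<forall>\<^sub>F t in at_right 0. (rval \<psi> (x + t *\<^sub>R (z - x)) - rval \<psi> x) / t \<le> rval \<psi> z - rval \<psi> x"
  proof -
    have "\<forall>\<^sub>F t in at_right 0. t < (1::real)" "\<forall>\<^sub>F t in at_right 0. (0::real) < t"
      by (auto simp: eventually_at_right_less intro: eventually_at_rightI[of 0 1])
    then show ?thesis
    proof eventually_elim
      case (elim t)
      have "rval \<psi> ((1 - t) *\<^sub>R x + t *\<^sub>R z) \<le> (1 - t) * rval \<psi> x + t * rval \<psi> z"
        using convex_on_rval[OF cpc] elim x by (intro convex_onD) auto
      moreover have "x + t *\<^sub>R (z - x) = (1 - t) *\<^sub>R x + t *\<^sub>R z" by (simp add: algebra_simps)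
      ultimately show ?case using elim by (simp add: field_simps)
    qed
  qed
  ultimately have "grad \<psi> x \<bullet> (z - x) \<le> rval \<psi> z - rval \<psi> x"
    by (rule tendsto_upperbound) simp
  then show ?thesis by simp
qed

lemma
  assumes "legendre \<psi>"
  shows legendre_cpc: "closed_proper_convex \<psi>"
    and legendre_differentiable: "\<And>x. x \<in> interior (edom \<psi>) \<Longrightarrow> rval \<psi> differentiable (at x)"
    and legendre_strict: "strictly_convex_on (interior (edom \<psi>)) (rval \<psi>)"
    and legendre_blowup: "\<And>xs x. (\<And>k::nat. xs k \<in> interior (edom \<psi>)) \<Longrightarrow> xs \<longlonglongrightarrow> x \<Longrightarrow>
      x \<in> frontier (edom \<psi>) \<Longrightarrow> filterlim (\<lambda>k. norm (grad \<psi> (xs k))) at_top sequentially"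
  using assms by (auto simp: legendre_def rval_def[abs_def])

lemma legendre_gradient_inequality:
  assumes "legendre \<psi>" "x \<in> interior (edom \<psi>)" "z \<in> edom \<psi>"
  shows "rval \<psi> x + grad \<psi> x \<bullet> (z - x) \<le> rval \<psi> z"
  using assms gradient_inequality legendre_cpc legendre_differentiable interior_subset by blast

text \<open>At a boundary point the directional derivative towards the interior is \<open>- \<infinity>\<close>: otherwise
  the gradients along the segment to \<open>a\<close> would stay bounded.\<close>

lemma legendre_interior_if_lower_bound:
  fixes \<psi> :: "'a::euclidean_space \<Rightarrow> ereal"
  assumes leg: "legendre \<psi>" and a: "a \<in> interior (edom \<psi>)" and x: "x \<in> edom \<psi>"
    and lower: "\<And>t. 0 < t \<Longrightarrow> t \<le> 1 \<Longrightarrow> rval \<psi> x + t * c \<le> rval \<psi> (x + t *\<^sub>R (a - x))"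
  shows "x \<in> interior (edom \<psi>)"
proof (rule ccontr)
  assume "x \<notin> interior (edom \<psi>)"
  then have fr: "x \<in> frontier (edom \<psi>)"
    using x closure_subset by (auto simp: frontier_def)
  note cpc = legendre_cpc[OF leg]
  have conv: "convex (edom \<psi>)" using convex_on_rval[OF cpc] by (rule convex_on_imp_convex)
  define z where "z t = x + t *\<^sub>R (a - x)" for t :: real
  have zi: "z t \<in> interior (edom \<psi>)" if "0 < t" "t \<le> 1" for t
  proof -
    have "z t = x - t *\<^sub>R (x - a)" by (simp add: z_def algebra_simps)
    then show ?thesis using mem_interior_convex_shrink[OF conv a x] that by simp
  qed
  have "continuous_on (interior (edom \<psi>)) (rval \<psi>)"
    using legendre_differentiable[OF leg]
    by (intro differentiable_imp_continuous_on) (auto simp: differentiable_on_def intro: differentiable_at_withinI)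
  moreover obtain e where e: "0 < e" "cball a e \<subseteq> interior (edom \<psi>)"
    using a open_contains_cball[of "interior (edom \<psi>)"] by auto
  ultimately have "compact (rval \<psi> ` cball a e)"
    by (intro compact_continuous_image) (auto intro: continuous_on_subset)
  then obtain M where M: "\<And>w. w \<in> cball a e \<Longrightarrow> rval \<psi> w \<le> M"
    using bounded_has_Sup(1)[of "rval \<psi> ` cball a e"] compact_imp_bounded e(1)
    by (metis (no_types, lifting) bounded_imp_bdd_above bdd_above.E image_eqI)
  \<comment> \<open>The gradient inequality, tested at a point of the ball around \<open>a\<close>,
    yields \<open>e * norm g\<close> on its left side. The summand \<open>2 * \<bar>c\<bar>\<close>
    absorbs the terms \<open>t * c\<close> and \<open>(1 - t) * c\<close>.\<close>
  define K where "K = (M - rval \<psi> x + 2 * \<bar>c\<bar>) / e"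
  have bound: "norm (grad \<psi> (z t)) \<le> K" if t: "0 < t" "t \<le> 1" for t
  proof -
    define g where "g = grad \<psi> (z t)"
    \<comment> \<open>Testing at \<open>x\<close> itself transfers the assumed lower slope
      \<open>c\<close> to the gradient: \<open>c \<le> g \<bullet> (a - x)\<close>.\<close>
    have "rval \<psi> (z t) + g \<bullet> (x - z t) \<le> rval \<psi> x"
      unfolding g_def using leg zi[OF t] x by (rule legendre_gradient_inequality)
    moreover have "rval \<psi> x + t * c \<le> rval \<psi> (z t)" using lower t by (simp add: z_def)
    moreover have "x - z t = (- t) *\<^sub>R (a - x)" by (simp add: z_def)
    ultimately have "t * c \<le> t * (g \<bullet> (a - x))" by simp
    then have c: "c \<le> g \<bullet> (a - x)" using t by simp
    \<comment> \<open>The test point is moved from \<open>a\<close> in the direction of the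
      gradient, so that the inner product picks up the full norm of \<open>g\<close>.\<close>
    define w where "w = a + e *\<^sub>R sgn g"
    have w: "w \<in> cball a e" using e(1) by (simp add: w_def dist_norm norm_sgn)
    then have "rval \<psi> (z t) + g \<bullet> (w - z t) \<le> rval \<psi> w"
      unfolding g_def using leg zi[OF t] e(2) interior_subset[of "edom \<psi>"]
      by (intro legendre_gradient_inequality) (auto simp del: mem_cball)
    moreover have "g \<bullet> (w - z t) = (1 - t) * (g \<bullet> (a - x)) + e * norm g"
    proof -
      have "w - z t = (1 - t) *\<^sub>R (a - x) + e *\<^sub>R sgn g" by (simp add: w_def z_def algebra_simps)
      moreover have "g \<bullet> sgn g = norm g"
        by (cases "g = 0") (simp_all add: sgn_div_norm power2_norm_eq_inner[symmetric] power2_eq_square)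
      ultimately show ?thesis by (simp add: inner_add_right)
    qed
    moreover have "(1 - t) * c \<le> (1 - t) * (g \<bullet> (a - x))"
      using c t by (intro mult_left_mono) auto
    moreover have "\<bar>(1 - t) * c\<bar> \<le> \<bar>c\<bar>" "\<bar>t * c\<bar> \<le> \<bar>c\<bar>"
      using t by (auto simp: abs_mult mult_left_le_one_le)
    ultimately have "e * norm g \<le> M - rval \<psi> x + 2 * \<bar>c\<bar>"
      using M[OF w] \<open>rval \<psi> x + t * c \<le> rval \<psi> (z t)\<close> by linarith
    then show ?thesis using e(1) by (simp add: K_def g_def field_simps)
  qed
  define xs where "xs k = z (1 / real (Suc k))" for k
  have "xs \<longlonglongrightarrow> x + 0 *\<^sub>R (a - x)"
    unfolding xs_def z_def by (intro tendsto_intros LIMSEQ_Suc[OF lim_1_over_n])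
  then have "filterlim (\<lambda>k. norm (grad \<psi> (xs k))) at_top sequentially"
    using fr zi by (intro legendre_blowup[OF leg, of xs x]) (auto simp: xs_def[of k for k])
  then have "\<forall>\<^sub>F k in sequentially. K + 1 \<le> norm (grad \<psi> (xs k))" by (simp add: filterlim_at_top)
  then obtain k where "K + 1 \<le> norm (grad \<psi> (xs k))"
    by (auto simp: eventually_sequentially)
  then show False using bound[of "1 / real (Suc k)"] by (simp add: xs_def)
qed

text \<open>Every \<open>w\<close> near \<open>g\<close> is a gradient, so its gradient inequality
  is an affine minorant of slope \<open>w\<close>. The slopes \<open>g + e *\<^sub>R b\<close> and
  \<open>g - e *\<^sub>R b\<close> control the coordinate along \<open>b\<close>; averaging over the
  basis controls the norm.\<close>

lemma legendre_coercive:
  fixes \<psi> :: "'a::euclidean_space \<Rightarrow> ereal"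
  assumes leg: "legendre \<psi>" and g: "g \<in> interior (grad_ran \<psi>)"
  shows "\<exists>\<delta>>0. \<exists>c. \<forall>z\<in>edom \<psi>. \<delta> * norm z \<le> rval \<psi> z - g \<bullet> z + c"
proof -
  obtain e where e: "0 < e" "cball g e \<subseteq> grad_ran \<psi>" using g mem_interior_cball by blast
  have "\<exists>k. \<forall>z\<in>edom \<psi>. w \<bullet> z \<le> rval \<psi> z + k" if w: "w \<in> cball g e" for w
  proof -
    obtain x where "x \<in> interior (edom \<psi>)" "grad \<psi> x = w" using w e by (auto simp: grad_ran_def)
    then have "w \<bullet> z \<le> rval \<psi> z + (w \<bullet> x - rval \<psi> x)" if "z \<in> edom \<psi>" for z
      using legendre_gradient_inequality[OF leg _ that, of x] by (simp add: inner_diff_right)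
    then show ?thesis by blast
  qed
  then obtain k where k: "\<And>w z. w \<in> cball g e \<Longrightarrow> z \<in> edom \<psi> \<Longrightarrow> w \<bullet> z \<le> rval \<psi> z + k w" by metis
  define kk where "kk b = \<bar>k (g + e *\<^sub>R b)\<bar> + \<bar>k (g - e *\<^sub>R b)\<bar>" for b
  have coord: "e * \<bar>z \<bullet> b\<bar> \<le> rval \<psi> z - g \<bullet> z + kk b" if "z \<in> edom \<psi>" "b \<in> Basis" for z b
  proof -
    have "(g + e *\<^sub>R b) \<bullet> z \<le> rval \<psi> z + k (g + e *\<^sub>R b)" "(g - e *\<^sub>R b) \<bullet> z \<le> rval \<psi> z + k (g - e *\<^sub>R b)"
      using that e(1) by (auto intro!: k simp: dist_norm)
    then have "e * (z \<bullet> b) \<le> rval \<psi> z - g \<bullet> z + kk b" "- (e * (z \<bullet> b)) \<le> rval \<psi> z - g \<bullet> z + kk b"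
      by (auto simp: kk_def inner_add_left inner_diff_left inner_commute[of z])
    then show ?thesis using e(1) by (auto simp: abs_if)
  qed
  define N where "N = real DIM('a)"
  have N: "0 < N" by (simp add: N_def)
  have "e / N * norm z \<le> rval \<psi> z - g \<bullet> z + (\<Sum>b\<in>Basis. kk b) / N" if "z \<in> edom \<psi>" for z
  proof -
    have "e * norm z \<le> e * (\<Sum>b\<in>Basis. \<bar>z \<bullet> b\<bar>)" using e(1) norm_le_l1[of z] by simp
    also have "\<dots> \<le> (\<Sum>b\<in>Basis. rval \<psi> z - g \<bullet> z + kk b)"
      unfolding sum_distrib_left using coord that by (intro sum_mono) auto
    also have "\<dots> = N * (rval \<psi> z - g \<bullet> z) + (\<Sum>b\<in>Basis. kk b)" by (simp add: sum.distrib N_def)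
    finally show ?thesis using N by (simp add: field_simps)
  qed
  then show ?thesis using e(1) N by (intro exI[of _ "e / N"]) auto
qed

section \<open>Linear growth and attainment of minima\<close>

lemma pos_homogeneous_lower_bound:
  fixes q :: "'a::euclidean_space \<Rightarrow> real"
  assumes cont: "continuous_on UNIV q" and hom: "\<And>t x. 0 \<le> t \<Longrightarrow> q (t *\<^sub>R x) = t * q x"
    and pos: "\<And>x. x \<noteq> 0 \<Longrightarrow> 0 < q x"
  shows "\<exists>\<delta>>0. \<forall>x. \<delta> * norm x \<le> q x"
proof -
  \<comment> \<open>The minimum over the unit sphere is positive and, by homogeneity, serves as the
    constant.\<close>
  have "\<exists>u\<in>sphere 0 1. \<forall>x\<in>sphere 0 1. q u \<le> q x"
    by (intro continuous_attains_inf continuous_on_subset[OF cont]) auto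
  then obtain u where u: "norm u = 1" "\<And>x. norm x = 1 \<Longrightarrow> q u \<le> q x" by auto
  have "q u * norm x \<le> q x" for x
  proof (cases "x = 0")
    case True then show ?thesis using hom[of 0 0] by simp
  next
    case False
    then have "norm (sgn x) = 1" by (simp add: norm_sgn)
    then have "norm x * q u \<le> norm x * q (sgn x)" using u(2) by (intro mult_left_mono) auto
    also have "\<dots> = q (norm x *\<^sub>R sgn x)" by (simp add: hom)
    also have "norm x *\<^sub>R sgn x = x" using False by (simp add: sgn_div_norm)
    finally show ?thesis by (simp add: mult.commute)
  qed
  moreover have "0 < q u" using u(1) by (intro pos) auto
  ultimately show ?thesis by blast
qed

lemma coercive_attains_min:
  fixes \<psi> :: "real^'n \<Rightarrow> ereal" and X :: "real^'p^'n" and l :: "real^'p \<Rightarrow> real"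
  assumes cpc: "closed_proper_convex \<psi>" and cont: "continuous_on UNIV l"
    and b0: "X *v b0 \<in> edom \<psi>" and \<delta>: "0 < \<delta>"
    and coer: "\<And>b. X *v b \<in> edom \<psi> \<Longrightarrow> \<delta> * norm b - c \<le> rval \<psi> (X *v b) + l b"
  shows "\<exists>b. X *v b \<in> edom \<psi> \<and>
    (\<forall>b'. X *v b' \<in> edom \<psi> \<longrightarrow> rval \<psi> (X *v b) + l b \<le> rval \<psi> (X *v b') + l b')"
proof -
  define F where "F b = rval \<psi> (X *v b) + l b" for b
  \<comment> \<open>Lower semicontinuity is given as closedness of the epigraph, so instead of
    \<open>F\<close> the continuous function \<open>t + l b\<close> is minimised over this lifted
    sublevel set, which is shown to be compact.\<close>
  define T where "T = {(b, t). (X *v b, t) \<in> epi \<psi> \<and> t + l b \<le> F b0}"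
  have T_iff: "(b, t) \<in> T \<longleftrightarrow> X *v b \<in> edom \<psi> \<and> rval \<psi> (X *v b) \<le> t \<and> t + l b \<le> F b0" for b t
    by (auto simp: T_def mem_epi_iff[OF cpc])
  have contp: "continuous_on UNIV (\<lambda>p :: (real^'p) \<times> real. l (fst p))"
    by (rule continuous_on_compose2[OF cont]) (auto intro: continuous_intros)
  have "closed ((\<lambda>(b, t). (X *v b, t)) -` epi \<psi>)"
    using cpc unfolding case_prod_unfold closed_proper_convex_def
    by (intro closed_vimage continuous_on_Pair continuous_on_snd continuous_on_id
        continuous_on_compose2[OF matrix_vector_mult_linear_continuous_on[of UNIV] continuous_on_fst[OF continuous_on_id]])
      simp_all
  moreover have "closed {p :: (real^'p) \<times> real. snd p + l (fst p) \<le> F b0}"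
    by (intro closed_Collect_le continuous_intros contp)
  moreover have "T = (\<lambda>(b, t). (X *v b, t)) -` epi \<psi> \<inter> {p. snd p + l (fst p) \<le> F b0}"
    by (auto simp: T_def)
  ultimately have "closed T" by (simp only: closed_Int)
  define R where "R = (F b0 + c) / \<delta>"
  have normb: "norm b \<le> R" if "(b, t) \<in> T" for b t
    using that coer[of b] \<delta> by (auto simp: T_iff R_def field_simps)
  have "compact (l ` cball 0 R)" using continuous_on_subset[OF cont] by (intro compact_continuous_image) auto
  then have "bounded (l ` cball 0 R)" by (rule compact_imp_bounded)
  then obtain m where "\<forall>x\<in>l ` cball 0 R. norm x \<le> m" unfolding bounded_iff by blast
  then have m: "\<bar>l b\<bar> \<le> m" if "norm b \<le> R" for b using that by simp
  \<comment> \<open>Once \<open>l\<close> is bounded by \<open>m\<close> on the ball, coercivity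
    bounds the height \<open>t\<close> from below and the sublevel condition bounds it from
    above.\<close>
  have "T \<subseteq> cball 0 R \<times> {- \<bar>c\<bar> - m .. F b0 + m}"
  proof clarify
    fix b t assume bt: "(b, t) \<in> T"
    have "0 \<le> \<delta> * norm b" using \<delta> by simp
    then show "b \<in> cball 0 R \<and> t \<in> {- \<bar>c\<bar> - m .. F b0 + m}"
      using bt m[OF normb[OF bt]] coer[of b] normb[OF bt] by (auto simp: T_iff)
  qed
  then have "bounded T" by (rule bounded_subset[rotated]) (intro bounded_Times bounded_cball bounded_closed_interval)
  then have "compact T" using \<open>closed T\<close> by (simp add: compact_eq_bounded_closed)
  moreover have b0T: "(b0, rval \<psi> (X *v b0)) \<in> T" using b0 by (simp add: T_iff F_def)
  moreover have "continuous_on T (\<lambda>p. snd p + l (fst p))"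
    by (intro continuous_intros continuous_on_subset[OF contp]) auto
  ultimately obtain p where p: "p \<in> T" "\<And>p'. p' \<in> T \<Longrightarrow> snd p + l (fst p) \<le> snd p' + l (fst p')"
    using continuous_attains_inf[of T "\<lambda>p. snd p + l (fst p)"] by blast
  obtain b t where bt: "p = (b, t)" by fastforce
  have b: "X *v b \<in> edom \<psi>" "F b \<le> t + l b" "t + l b \<le> F b0" using p(1) by (auto simp: bt T_iff F_def)
  have "F b \<le> F b'" if "X *v b' \<in> edom \<psi>" for b'
  proof (cases "F b' \<le> F b0")
    case True
    then have "(b', rval \<psi> (X *v b')) \<in> T" using that by (simp add: T_iff F_def)
    then show ?thesis using p(2) b by (force simp: bt F_def)
  next
    case False then show ?thesis using b by simp
  qed
  then show ?thesis using b(1) by (auto simp: F_def)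
qed

section \<open>Solutions of the generalized lasso\<close>

text \<open>The linear term of the objective is included, so that everything besides \<psi> forms
  one continuous, positively homogeneous function.\<close>

definition penalty :: "real^'p^'n \<Rightarrow> real^'p^'m \<Rightarrow> real \<Rightarrow> real^'n \<Rightarrow> real^'p \<Rightarrow> real" where
  "penalty X D lam y \<beta> = lam * (\<Sum>i\<in>UNIV. \<bar>(D *v \<beta>) $ i\<bar>) - y \<bullet> (X *v \<beta>)"

lemma continuous_on_penalty: "continuous_on UNIV (penalty X D lam y)"
  unfolding penalty_def
  by (intro continuous_intros matrix_vector_mult_linear_continuous_on)

lemma penalty_scaleR: "0 \<le> t \<Longrightarrow> penalty X D lam y (t *\<^sub>R \<beta>) = t * penalty X D lam y \<beta>"
  by (simp add: penalty_def matrix_vector_mult_scaleR abs_mult algebra_simps flip: sum_distrib_left)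

text \<open>The point 0 has finite objective, so no point with an infinite value can be a
  minimiser.\<close>

lemma is_solution_iff:
  assumes cpc: "closed_proper_convex \<psi>" and 0: "0 \<in> edom \<psi>"
  shows "is_solution X D lam \<psi> y \<beta> \<longleftrightarrow> X *v \<beta> \<in> edom \<psi> \<and>
    (\<forall>\<beta>'. X *v \<beta>' \<in> edom \<psi> \<longrightarrow>
       rval \<psi> (X *v \<beta>) + penalty X D lam y \<beta> \<le> rval \<psi> (X *v \<beta>') + penalty X D lam y \<beta>')"
proof -
  have fin: "objective X D lam \<psi> y b = ereal (rval \<psi> (X *v b) + penalty X D lam y b)"
    if "X *v b \<in> edom \<psi>" for b
    by (simp add: objective_def ereal_rval[OF cpc that] penalty_def algebra_simps)
  have inf: "objective X D lam \<psi> y b = \<infinity>" if "X *v b \<notin> edom \<psi>" for b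
    using that by (simp add: objective_def edom_def)
  have "X *v 0 \<in> edom \<psi>" using 0 by simp
  show ?thesis
  proof (cases "X *v \<beta> \<in> edom \<psi>")
    case True
    have "\<not> objective X D lam \<psi> y \<beta>' < objective X D lam \<psi> y \<beta> \<longleftrightarrow>
        (X *v \<beta>' \<in> edom \<psi> \<longrightarrow> rval \<psi> (X *v \<beta>) + penalty X D lam y \<beta>
          \<le> rval \<psi> (X *v \<beta>') + penalty X D lam y \<beta>')" for \<beta>'
      by (cases "X *v \<beta>' \<in> edom \<psi>") (simp_all add: fin inf True not_less)
    then show ?thesis using True by (simp add: is_solution_def is_arg_min_def)
  next
    case False
    have "objective X D lam \<psi> y 0 < objective X D lam \<psi> y \<beta>"
      using fin[OF \<open>X *v 0 \<in> edom \<psi>\<close>] inf[OF False] by simp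
    then show ?thesis using False by (auto simp: is_solution_def is_arg_min_def)
  qed
qed

lemma solution_exists:
  fixes X :: "real^'p^'n" and D :: "real^'p^'m"
  assumes lam: "lam > 0" and leg: "legendre \<psi>" and 0: "0 \<in> edom \<psi>"
    and null: "null_sp X \<inter> null_sp D = {0}"
    and y: "y \<in> interior (grad_ran \<psi>) + C_set X D lam"
  shows "\<exists>\<beta>. is_solution X D lam \<psi> y \<beta>"
proof -
  obtain g v u where g: "g \<in> interior (grad_ran \<psi>)" and y_eq: "y = g + v"
    and u: "transpose X *v v = transpose D *v u" "infnorm u \<le> lam"
    using y by (auto simp: C_set_def elim!: set_plus_elim)
  obtain \<delta> c where \<delta>: "0 < \<delta>" and c: "\<And>z. z \<in> edom \<psi> \<Longrightarrow> \<delta> * norm z \<le> rval \<psi> z - g \<bullet> z + c"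
    using legendre_coercive[OF leg g] by blast
  have vu: "v \<bullet> (X *v b) = u \<bullet> (D *v b)" for b
    using u(1) by (metis dot_lmul_matrix transpose_matrix_vector)
  define h where "h b = lam * (\<Sum>i\<in>UNIV. \<bar>(D *v b) $ i\<bar>) - u \<bullet> (D *v b)" for b
  have h0: "0 \<le> h b" for b
  proof -
    have "u \<bullet> (D *v b) \<le> (\<Sum>i\<in>UNIV. lam * \<bar>(D *v b) $ i\<bar>)"
      unfolding inner_vec_def
    proof (rule sum_mono)
      fix i
      have "u $ i \<bullet> (D *v b) $ i \<le> \<bar>u $ i\<bar> * \<bar>(D *v b) $ i\<bar>" by (metis abs_ge_self abs_mult inner_real_def)
      also have "\<dots> \<le> lam * \<bar>(D *v b) $ i\<bar>"
        using component_le_infnorm_cart[of u i] u(2) by (intro mult_right_mono) auto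
      finally show "u $ i \<bullet> (D *v b) $ i \<le> lam * \<bar>(D *v b) $ i\<bar>" .
    qed
    then show ?thesis by (simp add: h_def sum_distrib_left)
  qed
  \<comment> \<open>Up to a constant, \<open>q\<close> bounds the objective from below. It is
    positive away from 0: if \<open>X *v b = 0\<close>, then \<open>u \<bullet> (D *v b) = 0\<close>
    by \<open>vu\<close>, and \<open>h b\<close> reduces to \<open>lam\<close> times the l1 norm of
    \<open>D *v b\<close>, which is nonzero.\<close>
  define q where "q b = \<delta> * norm (X *v b) + h b" for b
  have "continuous_on UNIV q" unfolding q_def h_def
    by (intro continuous_intros matrix_vector_mult_linear_continuous_on)
  moreover have "q (t *\<^sub>R b) = t * q b" if "0 \<le> t" for t b
    using that by (simp add: q_def h_def matrix_vector_mult_scaleR abs_mult algebra_simps flip: sum_distrib_left)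
  moreover have "0 < q b" if "b \<noteq> 0" for b
  proof (cases "X *v b = 0")
    case True
    then have "D *v b \<noteq> 0" using null that by (auto simp: null_sp_def)
    then obtain i where "(D *v b) $ i \<noteq> 0" by (auto simp: vec_eq_iff)
    then have "0 < (\<Sum>i\<in>UNIV. \<bar>(D *v b) $ i\<bar>)" by (intro sum_pos2[of _ i]) auto
    then show ?thesis using True vu[of b] lam by (simp add: q_def h_def)
  next
    case False
    then show ?thesis using \<delta> h0[of b] by (simp add: q_def add_pos_nonneg)
  qed
  ultimately obtain \<epsilon> where \<epsilon>: "0 < \<epsilon>" "\<And>b. \<epsilon> * norm b \<le> q b"
    using pos_homogeneous_lower_bound[of q] by blast
  have "\<epsilon> * norm b - c \<le> rval \<psi> (X *v b) + penalty X D lam y b" if "X *v b \<in> edom \<psi>" for b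
    using c[OF that] \<epsilon>(2)[of b] by (simp add: q_def h_def penalty_def y_eq inner_add_left vu)
  from coercive_attains_min[OF legendre_cpc[OF leg] continuous_on_penalty _ \<epsilon>(1) this, of 0] 0
  show ?thesis by (simp add: is_solution_iff[OF legendre_cpc[OF leg] 0])
qed

text \<open>Compare the solution with its shrinkings \<open>(1 - t) *\<^sub>R \<beta>\<close>, whose
  images run from \<open>X *v \<beta>\<close> towards 0. The penalty scales linearly, so optimality
  bounds \<psi> from below on this segment with slope
  \<open>penalty X D lam y \<beta>\<close>.\<close>

lemma solution_in_interior:
  assumes leg: "legendre \<psi>" and 0: "0 \<in> interior (edom \<psi>)" and sol: "is_solution X D lam \<psi> y \<beta>"
  shows "X *v \<beta> \<in> interior (edom \<psi>)"
proof (rule legendre_interior_if_lower_bound[OF leg 0])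
  note cpc = legendre_cpc[OF leg]
  have dom0: "0 \<in> edom \<psi>" using 0 interior_subset by blast
  note sol = sol[unfolded is_solution_iff[OF cpc dom0]]
  show x: "X *v \<beta> \<in> edom \<psi>" using sol by blast
  fix t :: real assume t: "0 < t" "t \<le> 1"
  have eq: "X *v ((1 - t) *\<^sub>R \<beta>) = (1 - t) *\<^sub>R (X *v \<beta>)" by (simp add: matrix_vector_mult_scaleR)
  have "(1 - t) *\<^sub>R (X *v \<beta>) + t *\<^sub>R 0 \<in> edom \<psi>"
    using convex_on_imp_convex[OF convex_on_rval[OF cpc]] x dom0 t by (intro convexD) auto
  then have "rval \<psi> (X *v \<beta>) + penalty X D lam y \<beta> \<le>
      rval \<psi> ((1 - t) *\<^sub>R (X *v \<beta>)) + penalty X D lam y ((1 - t) *\<^sub>R \<beta>)"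
    using sol eq by (metis add.right_neutral scaleR_zero_right)
  moreover have "X *v \<beta> + t *\<^sub>R (0 - X *v \<beta>) = (1 - t) *\<^sub>R (X *v \<beta>)" by (simp add: algebra_simps)
  moreover have "penalty X D lam y ((1 - t) *\<^sub>R \<beta>) = (1 - t) * penalty X D lam y \<beta>"
    using t by (intro penalty_scaleR) simp
  ultimately show "rval \<psi> (X *v \<beta>) + t * penalty X D lam y \<beta> \<le> rval \<psi> (X *v \<beta> + t *\<^sub>R (0 - X *v \<beta>))"
    by (simp only: left_diff_distrib)
qed

section \<open>Stationarity and uniqueness of solutions\<close>

lemma inner_transpose_rows_on:
  fixes D :: "real^'p^'m"
  shows "(transpose (rows_on D A) *v s) \<bullet> d = (\<Sum>i\<in>A. s $ i * (D *v d) $ i)"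
proof -
  have "(rows_on D A *v d) $ i = (if i \<in> A then (D *v d) $ i else 0)" for i
    by (simp add: rows_on_def matrix_vector_mult_def)
  moreover have "(transpose (rows_on D A) *v s) \<bullet> d = s \<bullet> (rows_on D A *v d)"
    by (metis dot_lmul_matrix transpose_matrix_vector)
  ultimately show ?thesis
    by (simp add: inner_vec_def if_distrib[of "\<lambda>a. _ * a"] sum.If_cases cong: if_cong)
qed

lemma null_sp_rows_on: "d \<in> null_sp (rows_on D A) \<longleftrightarrow> (\<forall>i\<in>A. (D *v d) $ i = 0)"
  by (auto simp: null_sp_def rows_on_def matrix_vector_mult_def vec_eq_iff)

lemma abs_line_has_derivative:
  fixes a e :: real
  assumes "a \<noteq> 0 \<or> e = 0"
  shows "((\<lambda>t. \<bar>a + t * e\<bar>) has_real_derivative sgn a * e) (at 0)"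
proof (cases "e = 0")
  case False
  then have "DERIV abs (a + 0 * e) :> sgn a" using assms GDERIV_norm[of a] by simp
  moreover have "((\<lambda>t. a + t * e) has_real_derivative e) (at 0)"
    by (auto intro!: derivative_eq_intros)
  ultimately show ?thesis by (rule DERIV_chain2)
qed simp

text \<open>Stationarity along directions that keep the zero pattern of \<open>D *v \<beta>\<close>, on which the
  \<open>\<ell>\<^sub>1\<close> norm is linear near \<open>\<beta>\<close>.\<close>

lemma solution_stationary:
  fixes X :: "real^'p^'n" and D :: "real^'p^'m"
  assumes leg: "legendre \<psi>" and 0: "0 \<in> interior (edom \<psi>)" and sol: "is_solution X D lam \<psi> y \<beta>"
    and A: "A = {i. (D *v \<beta>) $ i \<noteq> 0}" and d: "d \<in> null_sp (rows_on D (- A))"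
  shows "(y - grad \<psi> (X *v \<beta>)) \<bullet> (X *v d) =
    lam * ((transpose (rows_on D A) *v (\<chi> i. sgn ((D *v \<beta>) $ i))) \<bullet> d)"
proof -
  have dom0: "0 \<in> edom \<psi>" using 0 interior_subset by blast
  have int: "X *v \<beta> \<in> interior (edom \<psi>)" by (rule solution_in_interior[OF leg 0 sol])
  define f where "f t = rval \<psi> (X *v \<beta> + t *\<^sub>R (X *v d)) +
      (lam * (\<Sum>i\<in>UNIV. \<bar>(D *v \<beta>) $ i + t * (D *v d) $ i\<bar>) - y \<bullet> (X *v \<beta>) - t * (y \<bullet> (X *v d)))" for t
  have f: "f t = rval \<psi> (X *v (\<beta> + t *\<^sub>R d)) + penalty X D lam y (\<beta> + t *\<^sub>R d)" for t
    by (simp add: f_def penalty_def matrix_vector_right_distrib matrix_vector_mult_scaleR inner_add_right)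
  have "(f has_real_derivative grad \<psi> (X *v \<beta>) \<bullet> (X *v d) +
      (lam * (\<Sum>i\<in>UNIV. sgn ((D *v \<beta>) $ i) * (D *v d) $ i) - 0 - y \<bullet> (X *v d))) (at 0)"
    unfolding f_def[abs_def]
  proof (intro DERIV_add DERIV_diff DERIV_cmult DERIV_sum DERIV_const)
    show "((\<lambda>t. rval \<psi> (X *v \<beta> + t *\<^sub>R (X *v d))) has_real_derivative grad \<psi> (X *v \<beta>) \<bullet> (X *v d)) (at 0)"
      using leg int by (intro GDERIV_line GDERIV_grad legendre_differentiable)
    show "((\<lambda>t. \<bar>(D *v \<beta>) $ i + t * (D *v d) $ i\<bar>) has_real_derivative
        sgn ((D *v \<beta>) $ i) * (D *v d) $ i) (at 0)" for i
      using d A by (intro abs_line_has_derivative) (auto simp: null_sp_rows_on)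
    show "((\<lambda>t. t * (y \<bullet> (X *v d))) has_real_derivative y \<bullet> (X *v d)) (at 0)"
      by (auto intro!: derivative_eq_intros)
  qed
  moreover obtain e where e: "0 < e" "ball (X *v \<beta>) e \<subseteq> edom \<psi>" using int mem_interior by blast
  \<comment> \<open>For \<open>\<bar>t\<bar> < k\<close> the perturbed image stays in the ball
    inside the domain. The \<open>+ 1\<close> keeps \<open>k\<close> positive when
    \<open>X *v d = 0\<close>.\<close>
  define k where "k = e / (norm (X *v d) + 1)"
  have nd: "0 < norm (X *v d) + 1" by (simp add: add_nonneg_pos)
  have k: "0 < k" using e(1) nd by (simp add: k_def)
  moreover have "\<forall>t. \<bar>0 - t\<bar> < k \<longrightarrow> f 0 \<le> f t"
  proof (intro allI impI)
    fix t assume t: "\<bar>0 - t\<bar> < k"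
    have "norm (t *\<^sub>R (X *v d)) \<le> \<bar>t\<bar> * (norm (X *v d) + 1)" by (simp add: mult_left_mono)
    also have "\<dots> < k * (norm (X *v d) + 1)" using t nd by (intro mult_strict_right_mono) auto
    also have "\<dots> = e" using nd by (simp add: k_def)
    finally have "X *v \<beta> + t *\<^sub>R (X *v d) \<in> ball (X *v \<beta>) e" by (simp add: dist_norm)
    then have "X *v (\<beta> + t *\<^sub>R d) \<in> edom \<psi>"
      using e(2) by (auto simp: matrix_vector_right_distrib matrix_vector_mult_scaleR)
    then show "f 0 \<le> f t"
      using sol unfolding f is_solution_iff[OF legendre_cpc[OF leg] dom0] by simp
  qed
  ultimately have "grad \<psi> (X *v \<beta>) \<bullet> (X *v d) +
      (lam * (\<Sum>i\<in>UNIV. sgn ((D *v \<beta>) $ i) * (D *v d) $ i) - 0 - y \<bullet> (X *v d)) = 0"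
    by (rule DERIV_local_min)
  moreover have "(\<Sum>i\<in>UNIV. sgn ((D *v \<beta>) $ i) * (D *v d) $ i) =
      (\<Sum>i\<in>A. sgn ((D *v \<beta>) $ i) * (D *v d) $ i)"
    unfolding A by (intro sum.mono_neutral_right) auto
  ultimately show ?thesis unfolding inner_transpose_rows_on inner_diff_left by simp
qed

text \<open>The objective at the midpoint is the average of the two optimal values, lowered by any
  strict convexity gain of \<psi> and by \<open>lam / 2\<close> times the total triangle inequality
  defect \<open>gap\<close>. Optimality rules out both reductions.\<close>

lemma solutions_midpoint:
  fixes X :: "real^'p^'n" and D :: "real^'p^'m"
  assumes lam: "lam > 0" and leg: "legendre \<psi>" and 0: "0 \<in> interior (edom \<psi>)"
    and sol1: "is_solution X D lam \<psi> y \<beta>1" and sol2: "is_solution X D lam \<psi> y \<beta>2"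
  shows "X *v \<beta>1 = X *v \<beta>2" "is_solution X D lam \<psi> y ((1/2) *\<^sub>R (\<beta>1 + \<beta>2))"
    and "\<And>i. \<bar>(D *v \<beta>1) $ i + (D *v \<beta>2) $ i\<bar> = \<bar>(D *v \<beta>1) $ i\<bar> + \<bar>(D *v \<beta>2) $ i\<bar>"
proof -
  define \<beta> where "\<beta> = (1/2) *\<^sub>R (\<beta>1 + \<beta>2)"
  have dom0: "0 \<in> edom \<psi>" using 0 interior_subset by blast
  note iff = is_solution_iff[OF legendre_cpc[OF leg] dom0]
  have i1: "X *v \<beta>1 \<in> interior (edom \<psi>)" and i2: "X *v \<beta>2 \<in> interior (edom \<psi>)"
    by (rule solution_in_interior[OF leg 0 sol1], rule solution_in_interior[OF leg 0 sol2])
  have eq: "rval \<psi> (X *v \<beta>1) + penalty X D lam y \<beta>1 = rval \<psi> (X *v \<beta>2) + penalty X D lam y \<beta>2"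
    using sol1 sol2 unfolding iff by (meson order_antisym)
  have X\<beta>: "X *v \<beta> = (1 - 1/2) *\<^sub>R (X *v \<beta>1) + (1/2) *\<^sub>R (X *v \<beta>2)"
    by (simp add: \<beta>_def matrix_vector_right_distrib matrix_vector_mult_scaleR scaleR_add_right)
  have D\<beta>: "(D *v \<beta>) $ i = ((D *v \<beta>1) $ i + (D *v \<beta>2) $ i) / 2" for i
    by (simp add: \<beta>_def matrix_vector_right_distrib matrix_vector_mult_scaleR)
  define gap where "gap i = \<bar>(D *v \<beta>1) $ i\<bar> + \<bar>(D *v \<beta>2) $ i\<bar> - \<bar>(D *v \<beta>1) $ i + (D *v \<beta>2) $ i\<bar>" for i
  have gap0: "0 \<le> gap i" for i using abs_triangle_ineq[of "(D *v \<beta>1) $ i" "(D *v \<beta>2) $ i"] by (simp add: gap_def)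
  have "(\<Sum>i\<in>UNIV. \<bar>(D *v \<beta>) $ i\<bar>) =
      (\<Sum>i\<in>UNIV. \<bar>(D *v \<beta>1) $ i\<bar> / 2 + \<bar>(D *v \<beta>2) $ i\<bar> / 2 - gap i / 2)"
    by (intro sum.cong) (auto simp: D\<beta> gap_def field_simps)
  then have sumD: "(\<Sum>i\<in>UNIV. \<bar>(D *v \<beta>) $ i\<bar>) = (\<Sum>i\<in>UNIV. \<bar>(D *v \<beta>1) $ i\<bar>) / 2 +
      (\<Sum>i\<in>UNIV. \<bar>(D *v \<beta>2) $ i\<bar>) / 2 - (\<Sum>i\<in>UNIV. gap i) / 2"
    by (simp add: sum.distrib sum_subtractf sum_divide_distrib)
  have pen: "penalty X D lam y \<beta> = penalty X D lam y \<beta>1 / 2 + penalty X D lam y \<beta>2 / 2 - lam * ((\<Sum>i\<in>UNIV. gap i) / 2)"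
    unfolding penalty_def sumD X\<beta> by (simp add: inner_add_right algebra_simps add_divide_distrib diff_divide_distrib)
  have "0 \<le> (\<Sum>i\<in>UNIV. gap i)" using gap0 by (simp add: sum_nonneg)
  then have lgap: "0 \<le> lam * ((\<Sum>i\<in>UNIV. gap i) / 2)" using lam by simp
  note strict = legendre_strict[OF leg, unfolded strictly_convex_on_def, THEN conjunct2, rule_format]
  have "convex (interior (edom \<psi>))"
    using legendre_strict[OF leg] by (simp add: strictly_convex_on_def)
  then have "X *v \<beta> \<in> interior (edom \<psi>)"
    unfolding X\<beta> using i1 i2 by (intro convexD) simp_all
  then have dom: "X *v \<beta> \<in> edom \<psi>" using interior_subset by blast
  then have min: "rval \<psi> (X *v \<beta>1) + penalty X D lam y \<beta>1 \<le> rval \<psi> (X *v \<beta>) + penalty X D lam y \<beta>"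
    using sol1 unfolding iff by blast
  show XX: "X *v \<beta>1 = X *v \<beta>2"
  proof (rule ccontr)
    assume "X *v \<beta>1 \<noteq> X *v \<beta>2"
    then have "rval \<psi> (X *v \<beta>) < (1 - 1/2) * rval \<psi> (X *v \<beta>1) + (1/2) * rval \<psi> (X *v \<beta>2)"
      unfolding X\<beta> by (intro strict[OF i1 i2]) simp_all
    then show False using pen lgap min eq by simp
  qed
  have "X *v \<beta> = X *v \<beta>1" unfolding X\<beta> XX by (simp only: flip: scaleR_add_left) simp
  then have "rval \<psi> (X *v \<beta>) = rval \<psi> (X *v \<beta>1)" "rval \<psi> (X *v \<beta>1) = rval \<psi> (X *v \<beta>2)" using XX by simp_all
  then have "lam * ((\<Sum>i\<in>UNIV. gap i) / 2) = 0"
    and le: "rval \<psi> (X *v \<beta>) + penalty X D lam y \<beta> \<le> rval \<psi> (X *v \<beta>1) + penalty X D lam y \<beta>1"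
    using pen lgap min eq by linarith+
  then have "(\<Sum>i\<in>UNIV. gap i) = 0" using lam by simp
  then have "gap i = 0" for i using gap0 by (simp add: sum_nonneg_eq_0_iff)
  then show "\<bar>(D *v \<beta>1) $ i + (D *v \<beta>2) $ i\<bar> = \<bar>(D *v \<beta>1) $ i\<bar> + \<bar>(D *v \<beta>2) $ i\<bar>" for i
    by (simp add: gap_def)
  show "is_solution X D lam \<psi> y ((1/2) *\<^sub>R (\<beta>1 + \<beta>2))"
    using sol1 le dom unfolding iff \<beta>_def[symmetric] by (meson order_trans)
qed

lemma solution_unique:
  fixes X :: "real^'p^'n" and D :: "real^'p^'m"
  assumes lam: "lam > 0" and leg: "legendre \<psi>" and 0: "0 \<in> interior (edom \<psi>)"
    and null: "null_sp X \<inter> null_sp D = {0}" and gen: "sign_generic D X"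
    and sol1: "is_solution X D lam \<psi> y \<beta>1" and sol2: "is_solution X D lam \<psi> y \<beta>2"
  shows "\<beta>1 = \<beta>2"
proof -
  define \<beta> where "\<beta> = (1/2) *\<^sub>R (\<beta>1 + \<beta>2)"
  define A where "A = {i. (D *v \<beta>) $ i \<noteq> 0}"
  define s where "s = (\<chi> i. sgn ((D *v \<beta>) $ i))"
  define w where "w = transpose (rows_on D A) *v s"
  define L where "L = null_sp (rows_on D (- A))"
  note mid = solutions_midpoint[OF lam leg 0 sol1 sol2, folded \<beta>_def]
  \<comment> \<open>The two solutions have no opposite signs in any row, so a sum of zero forces
    both entries to vanish.\<close>
  have off: "(D *v \<beta>1) $ i = 0 \<and> (D *v \<beta>2) $ i = 0" if "i \<notin> A" for i
  proof -
    have "(D *v \<beta>) $ i = ((D *v \<beta>1) $ i + (D *v \<beta>2) $ i) / 2"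
      by (simp add: \<beta>_def matrix_vector_right_distrib matrix_vector_mult_scaleR)
    then have "(D *v \<beta>1) $ i + (D *v \<beta>2) $ i = 0" using that by (simp add: A_def)
    then show ?thesis using mid(3)[of i] by linarith
  qed
  then have diff: "\<beta>1 - \<beta>2 \<in> null_sp X \<inter> L"
    using mid(1) by (auto simp: L_def null_sp_rows_on matrix_vector_mult_diff_distrib)
      (simp add: null_sp_def matrix_vector_mult_diff_distrib)
  have "sign_on A s" by (auto simp: sign_on_def s_def A_def sgn_if)
  then have gen': "(\<exists>r. \<forall>d\<in>L. r \<bullet> (X *v d) = w \<bullet> d) \<Longrightarrow> (\<exists>e\<in>L. w \<bullet> e \<noteq> 0) \<Longrightarrow> null_sp X \<inter> L = {0}"
    using gen unfolding sign_generic_def Let_def L_def w_def by blast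
  have "(y - grad \<psi> (X *v \<beta>)) \<bullet> (X *v d) = lam * (w \<bullet> d)" if "d \<in> L" for d
    using solution_stationary[OF leg 0 mid(2) A_def] that unfolding L_def w_def s_def by blast
  then have r: "\<forall>d\<in>L. ((1 / lam) *\<^sub>R (y - grad \<psi> (X *v \<beta>))) \<bullet> (X *v d) = w \<bullet> d" using lam by simp
  show ?thesis
  proof (cases "\<exists>e\<in>L. w \<bullet> e \<noteq> 0")
    case True
    then have "null_sp X \<inter> L = {0}" using gen' r by blast
    then show ?thesis using diff by auto
  next
    case False
    \<comment> \<open>Here \<open>w\<close> vanishes on \<open>L\<close>, in particular at the
      midpoint, where it evaluates to the l1 norm of \<open>D *v \<beta>\<close>.\<close>
    have "\<beta> \<in> L" by (auto simp: L_def null_sp_rows_on A_def)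
    then have "w \<bullet> \<beta> = 0" using False by blast
    moreover have "w \<bullet> \<beta> = (\<Sum>i\<in>A. \<bar>(D *v \<beta>) $ i\<bar>)"
      unfolding w_def inner_transpose_rows_on s_def by (simp add: abs_sgn mult.commute)
    ultimately have "A = {}" by (auto simp: sum_nonneg_eq_0_iff A_def)
    then have "L = null_sp D" by (auto simp: L_def null_sp_rows_on) (auto simp: null_sp_def vec_eq_iff)
    then show ?thesis using diff null by auto
  qed
qed

theorem theorem2:
  fixes D :: "real^'p^'m" and lam :: real and \<psi> :: "real^'n \<Rightarrow> ereal"
  assumes "lam > 0" and "legendre \<psi>" and "0 \<in> interior (edom \<psi>)"
  shows
    "(\<forall>X :: real^'p^'n. null_sp X \<inter> null_sp D = {0} \<and> D_general_position D X \<longrightarrow>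
        (\<forall>y \<in> - N_set X D lam \<psi> \<inter> (interior (grad_ran \<psi>) + C_set X D lam).
           \<exists>!\<beta>. is_solution X D lam \<psi> y \<beta>)) \<and>
     (\<forall>\<mu> :: (real^'p^'n) measure.
        prob_space \<mu> \<and> sets \<mu> = sets borel \<and> absolutely_continuous lborel \<mu> \<and>
        CARD('p) \<le> CARD('n) \<longrightarrow>
        (AE X in \<mu>. \<forall>y \<in> - N_set X D lam \<psi> \<inter> (interior (grad_ran \<psi>) + C_set X D lam).
           \<exists>!\<beta>. is_solution X D lam \<psi> y \<beta>)) \<and>
     (\<forall>\<mu> :: (real^'p^'n) measure.
        prob_space \<mu> \<and> sets \<mu> = sets borel \<and> absolutely_continuous lborel \<mu> \<and>
        CARD('p) > CARD('n) \<and> nullity D \<le> CARD('n) \<longrightarrow>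
        (AE X in \<mu>. \<forall>y \<in> - N_set X D lam \<psi> \<inter> (interior (grad_ran \<psi>) + C_set X D lam).
           \<exists>!\<beta>. is_solution X D lam \<psi> y \<beta>))"
proof -
  have 0: "0 \<in> edom \<psi>" using assms(3) interior_subset by blast
  have unique: "\<forall>y \<in> - N_set X D lam \<psi> \<inter> (interior (grad_ran \<psi>) + C_set X D lam).
      \<exists>!\<beta>. is_solution X D lam \<psi> y \<beta>"
    if "null_sp X \<inter> null_sp D = {0}" "sign_generic D X" for X :: "real^'p^'n"
    using solution_exists[OF assms(1,2) 0 that(1)] solution_unique[OF assms that] by blast
  have AE: "AE X in \<mu>. \<forall>y \<in> - N_set X D lam \<psi> \<inter> (interior (grad_ran \<psi>) + C_set X D lam).
      \<exists>!\<beta>. is_solution X D lam \<psi> y \<beta>"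
    if \<mu>: "sets \<mu> = sets borel" "absolutely_continuous lborel \<mu>" and D: "nullity D \<le> CARD('n)"
    for \<mu> :: "(real^'p^'n) measure"
  proof (rule absolutely_continuous_AE[of \<mu> lborel])
    have "AE X in lborel. null_sp (X :: real^'p^'n) \<inter> null_sp D = {0}"
      using D by (intro AE_null_sp_Int_eq_0 subspace_null_sp) (simp add: nullity_def)
    with AE_sign_generic
    show "AE X in lborel. \<forall>y \<in> - N_set X D lam \<psi> \<inter> (interior (grad_ran \<psi>) + C_set X D lam).
        \<exists>!\<beta>. is_solution X D lam \<psi> y \<beta>"
      by eventually_elim (use unique in blast)
  qed (use \<mu> in simp_all)
  \<comment> \<open>This reduces the case of at most as many columns as rows to the nullity bound,
    so both random cases are instances of \<open>AE\<close>.\<close>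
  have "nullity D \<le> CARD('p)" unfolding nullity_def by (metis dim_subset_UNIV_cart)
  then show ?thesis
    using unique AE sign_generic_if_D_general_position by (meson order_trans)
qed

end
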